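(* Let $N\ge 2$ and let $n$ be an integer not divisible by $N$. Any collection $\{\mathbf{M}_1,\dots,\mathbf{M}_N\}$ of real symmetric $2\times2$ matrices in a twist state (with winding number $n$) is an unstable orbit of the flow $$\frac{d\mathbf{M}_i}{dt}=\sum_{j=1}^N[\mathbf{M}_j,[\mathbf{M}_i,\mathbf{M}_j]],\qquad i=1,\dots,N,$$ in the sense that the corresponding fixed point of the rescaled system is unstable. More precisely, after rescaling for the algebraic decay of the eigenvalue difference, the $3N\times 3N$ Jacobian $\mathbf{J}$ of the rescaled system, evaluated at the fixed point $\sigma_j$ arbitrary, $\theta_j=\frac{\pi(j-1)n}{2N}$, $\Delta\lambda_j=1$ ($j=1,\dots,N$) corresponding to the twist state, has the following eigenvalues: $-N$ with multiplicity $1$, $N$ with multiplicity $2$, and $0$ with multiplicity $3N-3$.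
   Context: $[\mathbf{A},\mathbf{B}]=\mathbf{A}\mathbf{B}-\mathbf{B}\mathbf{A}$. Write each real symmetric $2\times 2$ matrix as $\mathbf{M}_j=\mathbf{R}(\theta_j)\,\mathrm{diag}(\lambda_j^1,\lambda_j^2)\,\mathbf{R}(-\theta_j)$ with $\mathbf{R}(\theta)=\begin{bmatrix}\cos\theta&\sin\theta\\-\sin\theta&\cos\theta\end{bmatrix}$, and set $\Delta\lambda_j=\lambda_j^2-\lambda_j^1$ and $\sigma_j=\lambda_j^1+\lambda_j^2=\mathrm{Tr}(\mathbf{M}_j)$. Twist state: the collection $\{\mathbf{M}_1,\dots,\mathbf{M}_N\}$ is in a twist state (with winding number $n$) if $\theta_j=\frac{\pi(j-1)n}{2N}$ for all $j$ (eigenvectors evenly spaced) and $\Delta\lambda_j$ is a nonzero constant independent of $j$. In the coordinates $(\sigma_j,\theta_j,\Delta\lambda_j)$ the flow $\dot{\mathbf{M}}_i=\sum_j[\mathbf{M}_j,[\mathbf{M}_i,\mathbf{M}_j]]$ reads $$\dot\sigma_j=0,\qquad \dot{\Delta\lambda}_j=-\Delta\lambda_j\sum_{k=1}^N(\Delta\lambda_k)^2\sin^2(2(\theta_k-\theta_j)),\qquad \dot\theta_j=\frac14\sum_{k=1}^N(\Delta\lambda_k)^2\sin(4(\theta_k-\theta_j)).$$ Starting from a twist state, the angles $\theta_j$ and traces $\sigma_j$ are constant in time and the common eigenvalue difference is $\Delta\lambda_j(t)=\alpha(t)=\frac{\alpha(0)}{\sqrt{1+N\alpha(0)^2t}}$,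 which solves $\dot\alpha=-\frac N2\alpha^3$. Rescaled system: replace $\Delta\lambda_j$ by $\Delta\lambda_j/\alpha(t)$ (i.e. rescale the trace-free part of each matrix by $\alpha(t)$) and time $t$ by $s$ with $ds=\alpha(t)^2dt$. Keeping the same symbols for the rescaled variables, one obtains the autonomous system in the $3N$ variables $(\sigma_j,\theta_j,\Delta\lambda_j)_{j=1}^N$ $$\frac{d\sigma_j}{ds}=0,\qquad \frac{d\theta_j}{ds}=\frac14\sum_{k=1}^N(\Delta\lambda_k)^2\sin(4(\theta_k-\theta_j)),$$ $$\frac{d\Delta\lambda_j}{ds}=-\Delta\lambda_j\sum_{k=1}^N(\Delta\lambda_k)^2\sin^2(2(\theta_k-\theta_j))+\frac N2\Delta\lambda_j,$$ and the twist state becomes a fixed point of this system with $\Delta\lambda_j=1$ for all $j$. The Jacobian $\mathbf{J}$ is the matrix of first partial derivatives of the right-hand side of this system with respect to $(\sigma,\theta,\Delta\lambda)$. "Unstable" means not Lyapunov stable as a fixed point of this system. *)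

theory Defs
  imports
    "HOL-Analysis.Analysis"
    "Jordan_Normal_Form.Spectral_Radius"
begin

text \<open>
  The \<open>2 \<times> 2\<close> matrices of the flow have type \<open>real^2^2\<close>. States of the coordinate system, and
  its Jacobian, have a size depending on \<open>N\<close>; they are the carrier-based vectors and matrices of
  \<open>Jordan_Normal_Form\<close>. To keep \<open>$\<close> for the latter, the notation of \<open>vec_nth\<close> is switched off.
  Families are indexed by \<open>{..<N}\<close>: the index \<open>j\<close> here is \<open>j + 1\<close> in the numbering \<open>1, \<dots>, N\<close>.
\<close>

unbundle no vec_syntax

subsection \<open>The matrix flow and twist states\<close>

definition commutator :: "real^2^2 \<Rightarrow> real^2^2 \<Rightarrow> real^2^2" where
  "commutator A B = A ** B - B ** A"

definition solves_matrix_flow :: "nat \<Rightarrow> real set \<Rightarrow> (real \<Rightarrow> nat \<Rightarrow> real^2^2) \<Rightarrow> bool" where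
  "solves_matrix_flow N I X \<longleftrightarrow>
     (\<forall>t\<in>I. \<forall>i<N. ((\<lambda>r. X r i) has_vector_derivative
        (\<Sum>j<N. commutator (X t j) (commutator (X t i) (X t j)))) (at t within I))"

definition rot :: "real \<Rightarrow> real^2^2" where
  "rot \<theta> = vector [vector [cos \<theta>, sin \<theta>], vector [- sin \<theta>, cos \<theta>]]"

definition diag2 :: "real \<Rightarrow> real \<Rightarrow> real^2^2" where
  "diag2 l1 l2 = vector [vector [l1, 0], vector [0, l2]]"

definition twist_angle :: "nat \<Rightarrow> int \<Rightarrow> nat \<Rightarrow> real" where
  "twist_angle N n j = pi * real j * of_int n / (2 * real N)"

text \<open>Here \<open>a\<close> is the common eigenvalue difference.\<close>

definition twist_state :: "nat \<Rightarrow> int \<Rightarrow> real \<Rightarrow> (nat \<Rightarrow> real^2^2) \<Rightarrow> bool" where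
  "twist_state N n a M \<longleftrightarrow> a \<noteq> 0 \<and>
     (\<forall>j<N. \<exists>l1 l2. l2 - l1 = a \<and>
        M j = rot (twist_angle N n j) ** diag2 l1 l2 ** rot (- twist_angle N n j))"

text \<open>The symmetric matrix with trace \<open>\<sigma>\<close>, eigenvector angle \<open>\<theta>\<close> and eigenvalue difference
  \<open>\<delta>\<close>, i.e. with eigenvalues \<open>l1 = (\<sigma> - \<delta>) / 2\<close> and \<open>l2 = (\<sigma> + \<delta>) / 2\<close>.\<close>

definition coord_matrix :: "real \<Rightarrow> real \<Rightarrow> real \<Rightarrow> real^2^2" where
  "coord_matrix \<sigma> \<theta> \<delta> = rot \<theta> ** diag2 ((\<sigma> - \<delta>) / 2) ((\<sigma> + \<delta>) / 2) ** rot (- \<theta>)"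

definition amplitude :: "nat \<Rightarrow> real \<Rightarrow> real \<Rightarrow> real" where
  "amplitude N a t = a / sqrt (1 + real N * a\<^sup>2 * t)"

definition twist_orbit :: "nat \<Rightarrow> int \<Rightarrow> real \<Rightarrow> (nat \<Rightarrow> real^2^2) \<Rightarrow> real \<Rightarrow> nat \<Rightarrow> real^2^2" where
  "twist_orbit N n a M t j = coord_matrix (trace (M j)) (twist_angle N n j) (amplitude N a t)"

subsection \<open>The rescaled system\<close>

text \<open>A state lists first all \<open>\<sigma>\<close>, then all \<open>\<theta>\<close>, then all \<open>\<Delta>\<lambda>\<close>.\<close>

definition mk_state :: "nat \<Rightarrow> (nat \<Rightarrow> real) \<Rightarrow> (nat \<Rightarrow> real) \<Rightarrow> (nat \<Rightarrow> real) \<Rightarrow> real vec" where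
  "mk_state N \<sigma> \<theta> \<delta> = vec (3 * N)
     (\<lambda>i. if i < N then \<sigma> i else if i < 2 * N then \<theta> (i - N) else \<delta> (i - 2 * N))"

definition trace_coord :: "real vec \<Rightarrow> nat \<Rightarrow> real" where
  "trace_coord x j = x $ j"

definition angle_coord :: "nat \<Rightarrow> real vec \<Rightarrow> nat \<Rightarrow> real" where
  "angle_coord N x j = x $ (N + j)"

definition gap_coord :: "nat \<Rightarrow> real vec \<Rightarrow> nat \<Rightarrow> real" where
  "gap_coord N x j = x $ (2 * N + j)"

definition rescaled_field :: "nat \<Rightarrow> real vec \<Rightarrow> real vec" where
  "rescaled_field N x = (let \<theta> = angle_coord N x; \<delta> = gap_coord N x in
     mk_state N
       (\<lambda>j. 0)
       (\<lambda>j. 1 / 4 * (\<Sum>k<N. (\<delta> k)\<^sup>2 * sin (4 * (\<theta> k - \<theta> j))))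
       (\<lambda>j. - \<delta> j * (\<Sum>k<N. (\<delta> k)\<^sup>2 * (sin (2 * (\<theta> k - \<theta> j)))\<^sup>2) + real N / 2 * \<delta> j))"

definition twist_point :: "nat \<Rightarrow> int \<Rightarrow> (nat \<Rightarrow> real) \<Rightarrow> real vec" where
  "twist_point N n \<sigma> = mk_state N \<sigma> (twist_angle N n) (\<lambda>_. 1)"

subsection \<open>Stability and Jacobian of an autonomous system on \<open>carrier_vec m\<close>\<close>

definition solves_ode :: "nat \<Rightarrow> (real vec \<Rightarrow> real vec) \<Rightarrow> real set \<Rightarrow> (real \<Rightarrow> real vec) \<Rightarrow> bool" where
  "solves_ode m F I x \<longleftrightarrow> (\<forall>s\<in>I. x s \<in> carrier_vec m \<and>
     (\<forall>i<m. ((\<lambda>r. x r $ i) has_real_derivative F (x s) $ i) (at s within I)))"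

definition euclid_dist :: "nat \<Rightarrow> real vec \<Rightarrow> real vec \<Rightarrow> real" where
  "euclid_dist m x y = L2_set (\<lambda>i. x $ i - y $ i) {..<m}"

text \<open>All solutions on all compact time intervals \<open>{0..T}\<close> are considered, so that no global
  existence is presupposed; a maximal solution that blows up leaves every bounded set.\<close>

definition lyapunov_stable :: "nat \<Rightarrow> (real vec \<Rightarrow> real vec) \<Rightarrow> real vec \<Rightarrow> bool" where
  "lyapunov_stable m F p \<longleftrightarrow> (\<forall>\<epsilon>>0. \<exists>\<delta>>0. \<forall>T\<ge>0. \<forall>x.
     solves_ode m F {0..T} x \<longrightarrow> euclid_dist m (x 0) p < \<delta> \<longrightarrow>
     (\<forall>s\<in>{0..T}. euclid_dist m (x s) p < \<epsilon>))"

text \<open>In entry \<open>(i, k)\<close>, coordinate \<open>k\<close> of \<open>p\<close> is replaced by the variable \<open>u\<close>.\<close>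

definition jacobian_mat :: "nat \<Rightarrow> (real vec \<Rightarrow> real vec) \<Rightarrow> real vec \<Rightarrow> real mat" where
  "jacobian_mat m F p = Matrix.mat m m (\<lambda>(i, k). deriv (\<lambda>u. F (update_vec p k u) $ i) (p $ k))"

subsection \<open>The rescaled system represents the matrix flow\<close>

lemma coord_matrix_eq:
  "coord_matrix \<sigma> \<theta> \<delta> =
     (\<sigma> / 2) *\<^sub>R diag2 1 1 - (\<delta> / 2 * cos (2 * \<theta>)) *\<^sub>R diag2 1 (-1)
     + (\<delta> / 2 * sin (2 * \<theta>)) *\<^sub>R vector [vector [0, 1], vector [1, 0]]"
proof -
  have c: "cos \<theta> * cos \<theta> = 1 - sin \<theta> * sin \<theta>"
    by (metis cos_squared_eq power2_eq_square)
  have c': "cos \<theta> * (cos \<theta> * z) = z - sin \<theta> * (sin \<theta> * z)" for z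
    using c by (simp add: mult.assoc[symmetric] left_diff_distrib)
  show ?thesis
    unfolding coord_matrix_def rot_def diag2_def
    by (simp add: Finite_Cartesian_Product.vec_eq_iff forall_2 matrix_matrix_mult_def sum_2
        vector_2 cos_double sin_double power2_eq_square)
      (simp add: field_simps c c')
qed

lemma commutator_coord_matrix:
  "commutator (coord_matrix \<sigma>' \<phi> \<gamma>) (commutator (coord_matrix \<sigma> \<theta> \<delta>) (coord_matrix \<sigma>' \<phi> \<gamma>)) =
     (\<delta> / 2 * \<gamma>\<^sup>2 * sin (2 * (\<phi> - \<theta>)) * sin (2 * \<phi>)) *\<^sub>R diag2 1 (-1)
     + (\<delta> / 2 * \<gamma>\<^sup>2 * sin (2 * (\<phi> - \<theta>)) * cos (2 * \<phi>)) *\<^sub>R vector [vector [0, 1], vector [1, 0]]"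
proof -
  have d: "sin (2 * (\<phi> - \<theta>)) = sin (2 * \<phi>) * cos (2 * \<theta>) - cos (2 * \<phi>) * sin (2 * \<theta>)"
    by (simp add: sin_diff right_diff_distrib)
  show ?thesis
    unfolding coord_matrix_eq commutator_def diag2_def d
    by (simp add: Finite_Cartesian_Product.vec_eq_iff forall_2 matrix_matrix_mult_def sum_2
        vector_2 power2_eq_square)
      (simp add: field_simps)
qed

text \<open>Solutions of the rescaled system yield solutions of the matrix flow: the eigenvalue
  differences are multiplied by \<open>\<alpha>(t)\<close>, and \<open>s(t) = ln (1 + N a\<^sup>2 t) / N\<close> is the
  integral of \<open>\<alpha>\<^sup>2\<close> over \<open>[0, t]\<close>.\<close>

theorem rescaled_solves_matrix_flow:
  fixes a S :: real and s :: "real \<Rightarrow> real"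
  assumes N: "N > 0" and x: "solves_ode (3 * N) (rescaled_field N) {0..S} x"
  defines "s \<equiv> \<lambda>t. ln (1 + real N * a\<^sup>2 * t) / real N"
  defines "I \<equiv> {t. 0 \<le> t \<and> s t \<le> S}"
  shows "solves_matrix_flow N I (\<lambda>t j. coord_matrix (trace_coord (x (s t)) j)
           (angle_coord N (x (s t)) j) (amplitude N a t * gap_coord N (x (s t)) j))"
  unfolding solves_matrix_flow_def
proof (intro ballI allI impI)
  fix t i assume t: "t \<in> I" and i: "i < N"
  define \<alpha> where "\<alpha> = amplitude N a"
  have pos: "1 + real N * a\<^sup>2 * r > 0" if "r \<ge> 0" for r
    using that by (simp add: add_pos_nonneg)
  have sI: "s ` I \<subseteq> {0..S}"
    using N by (auto simp: I_def s_def)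
  have st: "s t \<in> {0..S}" using t sI by blast
  have t0: "t \<ge> 0" using t by (simp add: I_def)
  have a2: "(\<alpha> t)\<^sup>2 = a\<^sup>2 / (1 + real N * a\<^sup>2 * t)"
    using pos[OF t0] by (simp add: \<alpha>_def amplitude_def power_divide)
  have ds: "(s has_real_derivative (\<alpha> t)\<^sup>2) (at t within I)"
    unfolding s_def a2 using pos[OF t0] N
    by (auto intro!: derivative_eq_intros)
  have d\<alpha>: "(\<alpha> has_real_derivative - real N / 2 * \<alpha> t ^ 3) (at t within I)"
  proof -
    have "(\<alpha> has_real_derivative
        - (a * (real N * a\<^sup>2 * inverse (sqrt (1 + real N * a\<^sup>2 * t)) / 2))
          / (sqrt (1 + real N * a\<^sup>2 * t))\<^sup>2) (at t within I)"
      unfolding \<alpha>_def amplitude_def using pos[OF t0]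
      by (auto intro!: derivative_eq_intros simp: power2_eq_square)
    moreover have "- (a * (real N * a\<^sup>2 * inverse (sqrt (1 + real N * a\<^sup>2 * t)) / 2))
          / (sqrt (1 + real N * a\<^sup>2 * t))\<^sup>2 = - real N / 2 * \<alpha> t ^ 3"
      unfolding \<alpha>_def amplitude_def
      by (simp add: field_simps power2_eq_square power3_eq_cube)
    ultimately show ?thesis by metis
  qed
  define \<sigma> where "\<sigma> r = trace_coord (x r)" for r
  define \<theta> where "\<theta> r = angle_coord N (x r)" for r
  define \<delta> where "\<delta> r = gap_coord N (x r)" for r
  have comp: "((\<lambda>r. x (s r) $ k) has_real_derivative
      rescaled_field N (x (s t)) $ k * (\<alpha> t)\<^sup>2) (at t within I)" if "k < 3 * N" for k
  proof -
    have "((\<lambda>r. x r $ k) has_real_derivative rescaled_field N (x (s t)) $ k) (at (s t) within s ` I)"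
      using x st that sI unfolding solves_ode_def by (blast intro: DERIV_subset)
    from DERIV_image_chain[OF this ds] show ?thesis
      by (simp add: o_def)
  qed
  have d\<sigma>: "((\<lambda>r. \<sigma> (s r) i) has_real_derivative 0) (at t within I)"
    using comp[of i] i
    by (simp add: \<sigma>_def trace_coord_def rescaled_field_def mk_state_def Let_def)
  have d\<theta>: "((\<lambda>r. \<theta> (s r) i) has_real_derivative
      (1 / 4 * (\<Sum>k<N. (\<delta> (s t) k)\<^sup>2 * sin (4 * (\<theta> (s t) k - \<theta> (s t) i)))) * (\<alpha> t)\<^sup>2)
      (at t within I)"
    using comp[of "N + i"] i
    by (simp add: \<theta>_def \<delta>_def angle_coord_def rescaled_field_def mk_state_def Let_def)
  have d\<delta>: "((\<lambda>r. \<delta> (s r) i) has_real_derivative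
      (- \<delta> (s t) i * (\<Sum>k<N. (\<delta> (s t) k)\<^sup>2 * (sin (2 * (\<theta> (s t) k - \<theta> (s t) i)))\<^sup>2)
       + real N / 2 * \<delta> (s t) i) * (\<alpha> t)\<^sup>2) (at t within I)"
    using comp[of "2 * N + i"] i
    by (simp add: \<theta>_def \<delta>_def gap_coord_def rescaled_field_def mk_state_def Let_def)
  define A where "A = (\<Sum>k<N. (\<delta> (s t) k)\<^sup>2 * sin (4 * (\<theta> (s t) k - \<theta> (s t) i)))"
  define B where "B = (\<Sum>k<N. (\<delta> (s t) k)\<^sup>2 * (sin (2 * (\<theta> (s t) k - \<theta> (s t) i)))\<^sup>2)"
  let ?E = "vector [vector [0, 1], vector [1, 0]] :: real^2^2"
  have D: "((\<lambda>r. \<alpha> r * \<delta> (s r) i) has_real_derivative - (\<alpha> t ^ 3 * \<delta> (s t) i * B))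
      (at t within I)"
    by (rule derivative_eq_intros d\<alpha> d\<delta>[folded B_def] refl)+
      (simp add: algebra_simps power2_eq_square power3_eq_cube)
  have T: "((\<lambda>r. \<theta> (s r) i) has_real_derivative A / 4 * (\<alpha> t)\<^sup>2) (at t within I)"
    using d\<theta>[folded A_def] by simp
  let ?th = "\<theta> (s t) i" and ?g = "\<alpha> t ^ 3 * \<delta> (s t) i / 2"
  have CS: "((\<lambda>r. - (g r / 2 * cos (2 * \<theta> (s r) i))) has_real_derivative
        - (g' / 2 * cos (2 * ?th) - g t / 2 * (sin (2 * ?th) * (2 * (A / 4 * (\<alpha> t)\<^sup>2)))))
        (at t within I)"
      "((\<lambda>r. g r / 2 * sin (2 * \<theta> (s r) i)) has_real_derivative
        g' / 2 * sin (2 * ?th) + g t / 2 * (cos (2 * ?th) * (2 * (A / 4 * (\<alpha> t)\<^sup>2))))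
        (at t within I)"
    if "(g has_real_derivative g') (at t within I)" for g g'
    by (rule derivative_eq_intros that T refl | simp add: algebra_simps add_divide_distrib diff_divide_distrib)+
  have C: "((\<lambda>r. - (\<alpha> r * \<delta> (s r) i / 2 * cos (2 * \<theta> (s r) i))) has_real_derivative
      ?g * (B * cos (2 * ?th) + A / 2 * sin (2 * ?th))) (at t within I)"
    by (rule DERIV_cong[OF CS(1)[OF D]])
      (simp add: algebra_simps power2_eq_square power3_eq_cube)
  have S: "((\<lambda>r. \<alpha> r * \<delta> (s r) i / 2 * sin (2 * \<theta> (s r) i)) has_real_derivative
      ?g * (A / 2 * cos (2 * ?th) - B * sin (2 * ?th))) (at t within I)"
    by (rule DERIV_cong[OF CS(2)[OF D]])
      (simp add: algebra_simps power2_eq_square power3_eq_cube)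
  have Z: "((\<lambda>r. \<sigma> (s r) i / 2) has_real_derivative 0) (at t within I)"
    by (rule derivative_eq_intros d\<sigma> refl)+ simp_all
  have deriv: "((\<lambda>r. (\<sigma> (s r) i / 2) *\<^sub>R diag2 1 1
        + (- (\<alpha> r * \<delta> (s r) i / 2 * cos (2 * \<theta> (s r) i))) *\<^sub>R diag2 1 (-1)
        + (\<alpha> r * \<delta> (s r) i / 2 * sin (2 * \<theta> (s r) i)) *\<^sub>R ?E) has_vector_derivative
      0 + (?g * (B * cos (2 * ?th) + A / 2 * sin (2 * ?th))) *\<^sub>R diag2 1 (-1)
        + (?g * (A / 2 * cos (2 * ?th) - B * sin (2 * ?th))) *\<^sub>R ?E) (at t within I)"
    using has_vector_derivative_scaleR[OF Z has_vector_derivative_const, of "diag2 1 1"]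
      has_vector_derivative_scaleR[OF C has_vector_derivative_const, of "diag2 1 (-1)"]
      has_vector_derivative_scaleR[OF S has_vector_derivative_const, of ?E]
    by (intro has_vector_derivative_add) (simp_all only: scaleR_zero_right add_0_left scaleR_zero_left)
  let ?d = "\<lambda>k. \<theta> (s t) k - ?th"
  have s4: "sin (4 * z) = 2 * sin (2 * z) * cos (2 * z)" for z :: real
    using sin_double[of "2 * z"] by simp
  have BC: "B * cos (2 * ?th) + A / 2 * sin (2 * ?th) =
      (\<Sum>k<N. (\<delta> (s t) k)\<^sup>2 * sin (2 * ?d k) * sin (2 * \<theta> (s t) k))"
  proof -
    have *: "sin (2 * \<theta> (s t) k) = sin (2 * ?d k) * cos (2 * ?th) + cos (2 * ?d k) * sin (2 * ?th)" for k
      using sin_add[of "2 * ?d k" "2 * ?th"] by (simp add: algebra_simps)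
    show ?thesis
      unfolding A_def B_def s4 sum_divide_distrib sum_distrib_right sum.distrib[symmetric]
    proof (intro sum.cong refl)
      fix k
      show "(\<delta> (s t) k)\<^sup>2 * (sin (2 * ?d k))\<^sup>2 * cos (2 * ?th) + (\<delta> (s t) k)\<^sup>2 * (2 * sin (2 * ?d k) * cos (2 * ?d k)) / 2 * sin (2 * ?th) =
          (\<delta> (s t) k)\<^sup>2 * sin (2 * ?d k) * sin (2 * \<theta> (s t) k)"
        unfolding *[of k] by (simp add: algebra_simps power2_eq_square)
    qed
  qed
  have BS: "A / 2 * cos (2 * ?th) - B * sin (2 * ?th) =
      (\<Sum>k<N. (\<delta> (s t) k)\<^sup>2 * sin (2 * ?d k) * cos (2 * \<theta> (s t) k))"
  proof -
    have *: "cos (2 * \<theta> (s t) k) = cos (2 * ?d k) * cos (2 * ?th) - sin (2 * ?d k) * sin (2 * ?th)" for k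
      using cos_add[of "2 * ?d k" "2 * ?th"] by (simp add: algebra_simps)
    show ?thesis
      unfolding A_def B_def s4 sum_divide_distrib sum_distrib_right sum_subtractf[symmetric]
    proof (intro sum.cong refl)
      fix k
      show "(\<delta> (s t) k)\<^sup>2 * (2 * sin (2 * ?d k) * cos (2 * ?d k)) / 2 * cos (2 * ?th) - (\<delta> (s t) k)\<^sup>2 * (sin (2 * ?d k))\<^sup>2 * sin (2 * ?th) =
          (\<delta> (s t) k)\<^sup>2 * sin (2 * ?d k) * cos (2 * \<theta> (s t) k)"
        unfolding *[of k] by (simp add: algebra_simps power2_eq_square)
    qed
  qed
  let ?X = "\<lambda>r k. coord_matrix (\<sigma> (s r) k) (\<theta> (s r) k) (\<alpha> r * \<delta> (s r) k)"
  have rhs: "(\<Sum>k<N. commutator (?X t k) (commutator (?X t i) (?X t k))) =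
      0 + (?g * (B * cos (2 * ?th) + A / 2 * sin (2 * ?th))) *\<^sub>R diag2 1 (-1)
        + (?g * (A / 2 * cos (2 * ?th) - B * sin (2 * ?th))) *\<^sub>R ?E"
    unfolding commutator_coord_matrix BC BS sum.distrib scaleR_sum_left[symmetric] sum_distrib_left
      add_0_left
    by (intro arg_cong2[where f = "(+)"] arg_cong2[where f = scaleR] sum.cong refl)
      (simp_all add: power2_eq_square power3_eq_cube)
  have lhs: "(\<lambda>r. ?X r i) = (\<lambda>r. (\<sigma> (s r) i / 2) *\<^sub>R diag2 1 1
        + (- (\<alpha> r * \<delta> (s r) i / 2 * cos (2 * \<theta> (s r) i))) *\<^sub>R diag2 1 (-1)
        + (\<alpha> r * \<delta> (s r) i / 2 * sin (2 * \<theta> (s r) i)) *\<^sub>R ?E)"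
    unfolding coord_matrix_eq by simp
  show "((\<lambda>t. coord_matrix (trace_coord (x (s t)) i) (angle_coord N (x (s t)) i)
          (amplitude N a t * gap_coord N (x (s t)) i)) has_vector_derivative
        (\<Sum>j<N. commutator
          (coord_matrix (trace_coord (x (s t)) j) (angle_coord N (x (s t)) j)
            (amplitude N a t * gap_coord N (x (s t)) j))
          (commutator
            (coord_matrix (trace_coord (x (s t)) i) (angle_coord N (x (s t)) i)
              (amplitude N a t * gap_coord N (x (s t)) i))
            (coord_matrix (trace_coord (x (s t)) j) (angle_coord N (x (s t)) j)
              (amplitude N a t * gap_coord N (x (s t)) j))))) (at t within I)"
    using deriv unfolding lhs[symmetric] rhs[symmetric] unfolding \<sigma>_def \<theta>_def \<delta>_def \<alpha>_def .
qed

end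

theory Submission
  imports Defs
begin

text \<open>
  The trace-free part of the \<open>j\<close>-th matrix is encoded by the plane vector
  \<open>v\<^sub>j = \<Delta>\<lambda>\<^sub>j (cos 2\<theta>\<^sub>j, sin 2\<theta>\<^sub>j)\<close>. With the Gram matrix \<open>P = \<Sum> v\<^sub>k v\<^sub>k\<^sup>T\<close>, the flow is
  \<open>v\<^sub>j' = - adj(P) v\<^sub>j\<close>, and the rescaled flow adds \<open>N/2 v\<^sub>j\<close>. So in the rescaled flow
  \<open>P' = N P - 2 det(P) 1\<close>: the trace-free part of \<open>P\<close>, which vanishes at a twist state, grows
  like \<open>exp (N s)\<close>. This anisotropy of the collection of vectors is the instability, and its two
  components account for the double eigenvalue \<open>N\<close>.

  Spectrum. At the twist point the Jacobian is a product \<open>U W\<close> of a \<open>3N \<times> 3\<close> and a \<open>3 \<times> 3N\<close>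
  matrix built from \<open>cos 4\<theta>\<^sub>j\<close> and \<open>sin 4\<theta>\<^sub>j\<close> (\<open>jacobian_twist_point_factorization\<close>), and
  \<open>W U = diag(N, N, -N)\<close> (\<open>twist_corange_mult_range\<close>). Since \<open>U W\<close> and \<open>W U\<close> have the same
  characteristic polynomial up to a power of the indeterminate (\<open>char_poly_mult_swap\<close>), all
  multiplicities follow.

  Instability. Rather than deduce instability from the positive eigenvalue by linearization, which
  requires existence of solutions of the nonlinear equations, a solution that leaves the fixed
  point is written down explicitly. If \<open>P\<close> is diagonal, the equations reduce to a scalar one that
  is solved by \<open>z / (1 - exp (- z))\<close> with \<open>z = d exp (N s)\<close>. This gives a curve of states,
  parametrized by \<open>z > 0\<close>, that emanates from the twist point at \<open>z = 0\<close>
  (\<open>unstable_state_tendsto\<close>) and is traversed by solutions (\<open>solves_ode_unstable_state\<close>).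
\<close>

section \<open>Characteristic polynomials of products\<close>

text \<open>
  The Weinstein--Aronszajn identity. The block matrix with rows \<open>(x, -A)\<close> and \<open>(B, 1)\<close> mediates:
  eliminating \<open>B\<close> by column operations leaves \<open>x + A B\<close> and \<open>1\<close> on the diagonal; eliminating it by
  row operations, after scaling the lower rows by \<open>x\<close>, leaves \<open>x\<close> and \<open>x + B A\<close>.
\<close>

lemma det_smult_one_plus_mult_swap:
  fixes x :: "'a :: idom"
  assumes A: "A \<in> carrier_mat m k" and B: "B \<in> carrier_mat k m"
  shows "x ^ k * det (x \<cdot>\<^sub>m 1\<^sub>m m + A * B) = x ^ m * det (x \<cdot>\<^sub>m 1\<^sub>m k + B * A)"
proof -
  let ?M = "four_block_mat (x \<cdot>\<^sub>m 1\<^sub>m m) (- A) B (1\<^sub>m k)"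
  let ?R = "four_block_mat (1\<^sub>m m) (0\<^sub>m m k) (- B) (1\<^sub>m k)"
  let ?L = "four_block_mat (1\<^sub>m m) (0\<^sub>m m k) (- B) (x \<cdot>\<^sub>m 1\<^sub>m k)"
  have M: "?M \<in> carrier_mat (m + k) (m + k)" and R: "?R \<in> carrier_mat (m + k) (m + k)"
    and L: "?L \<in> carrier_mat (m + k) (m + k)"
    using A B by auto
  have "?M * ?R = four_block_mat (x \<cdot>\<^sub>m 1\<^sub>m m + A * B) (- A) (0\<^sub>m k m) (1\<^sub>m k)"
    by (subst mult_four_block_mat[where ?nr1.0 = m and ?n1.0 = m and ?n2.0 = k and ?nr2.0 = k
          and ?nc1.0 = m and ?nc2.0 = k])
      (use A B in \<open>auto simp: uminus_l_inv_mat uminus_mult_left_mat uminus_mult_right_mat\<close>)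
  moreover have "det (four_block_mat (x \<cdot>\<^sub>m 1\<^sub>m m + A * B) (- A) (0\<^sub>m k m) (1\<^sub>m k))
      = det (x \<cdot>\<^sub>m 1\<^sub>m m + A * B)"
    by (subst det_four_block_mat_lower_left_zero[where n = m and m = k]) (use A B in auto)
  moreover have "det ?R = 1"
    by (subst det_four_block_mat_upper_right_zero[where n = m and m = k]) (use A B in auto)
  ultimately have 1: "det ?M = det (x \<cdot>\<^sub>m 1\<^sub>m m + A * B)"
    using det_mult[OF M R] by simp
  have "?L * ?M = four_block_mat (x \<cdot>\<^sub>m 1\<^sub>m m) (- A) (0\<^sub>m k m) (x \<cdot>\<^sub>m 1\<^sub>m k + B * A)"
    by (subst mult_four_block_mat[where ?nr1.0 = m and ?n1.0 = m and ?n2.0 = k and ?nr2.0 = k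
          and ?nc1.0 = m and ?nc2.0 = k])
      (use A B in \<open>auto simp: mult_smult_distrib comm_add_mat\<close>)
  moreover have "det (four_block_mat (x \<cdot>\<^sub>m 1\<^sub>m m) (- A) (0\<^sub>m k m) (x \<cdot>\<^sub>m 1\<^sub>m k + B * A))
      = x ^ m * det (x \<cdot>\<^sub>m 1\<^sub>m k + B * A)"
    by (subst det_four_block_mat_lower_left_zero[where n = m and m = k]) (use A B in \<open>auto simp: det_smult\<close>)
  moreover have "det ?L = x ^ k"
    by (subst det_four_block_mat_upper_right_zero[where n = m and m = k])
       (use A B in \<open>auto simp: det_smult\<close>)
  ultimately have "x ^ k * det ?M = x ^ m * det (x \<cdot>\<^sub>m 1\<^sub>m k + B * A)"
    using det_mult[OF L M] by simp
  thus ?thesis by (simp add: 1)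
qed

lemma char_poly_mult_swap:
  fixes A B :: "'a :: idom mat"
  assumes A: "A \<in> carrier_mat m k" and B: "B \<in> carrier_mat k m"
  shows "[:0, 1:] ^ k * char_poly (A * B) = [:0, 1:] ^ m * char_poly (B * A)"
proof -
  let ?C = "map_mat (\<lambda>a. [:a:]) :: 'a mat \<Rightarrow> 'a poly mat"
  interpret hom: semiring_hom "\<lambda>a. [:a:] :: 'a poly"
    by unfold_locales auto
  have neg: "map_mat (\<lambda>a. [:- a:]) (P * Q) = - ?C P * ?C Q"
    if "P \<in> carrier_mat r l" "Q \<in> carrier_mat l r" for P Q :: "'a mat" and r l
  proof -
    have "map_mat (\<lambda>a. [:- a:]) (P * Q) = - ?C (P * Q)"
      by (intro eq_matI) auto
    also have "?C (P * Q) = ?C P * ?C Q"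
      using that by (rule hom.mat_hom_mult)
    finally show ?thesis using that by (simp add: uminus_mult_left_mat)
  qed
  have AB: "char_poly (A * B) = det ([:0, 1:] \<cdot>\<^sub>m 1\<^sub>m m + (- ?C A) * ?C B)"
    using A B by (simp add: char_poly_def char_poly_matrix_def neg[OF A B])
  have "char_poly (B * A) = det ([:0, 1:] \<cdot>\<^sub>m 1\<^sub>m k + (- ?C B) * ?C A)"
    using A B by (simp add: char_poly_def char_poly_matrix_def neg[OF B A])
  also have "(- ?C B) * ?C A = ?C B * (- ?C A)"
    using A B by (simp add: uminus_mult_left_mat uminus_mult_right_mat)
  finally show ?thesis
    unfolding AB using A B det_smult_one_plus_mult_swap[of "- ?C A" m k "?C B" "[:0, 1:]"] by simp
qed

lemma order_linear_factors:
  fixes e :: complex and m :: nat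
  assumes "e \<noteq> 0"
  defines "p \<equiv> [:0, 1:] ^ m * ([:- e, 1:] ^ 2 * [:e, 1:])"
  shows "order (- e) p = 1" "order e p = 2" "order 0 p = m"
    and "{z. poly p z = 0} = (if m = 0 then {e, -e} else {-e, e, 0})"
proof -
  have o: "order a ([:- b, 1:] ^ r) = (if a = b then r else 0)" for a b :: complex and r
    using order_power_n_n[of a r] by (auto intro!: order_0I)
  have nz: "p \<noteq> 0" by (simp del: mult_pCons_left mult_pCons_right add: p_def)
  have "order a p = (if a = 0 then m else 0) + ((if a = e then 2 else 0) + (if a = - e then 1 else 0))" for a
    using nz o[of a 0 m] o[of a e 2] o[of a "-e" 1] unfolding p_def by (subst order_mult, simp, subst order_mult, auto)
  thus "order (- e) p = 1" "order e p = 2" "order 0 p = m" using assms by auto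
  show "{z. poly p z = 0} = (if m = 0 then {e, -e} else {-e, e, 0})"
    by (auto simp del: mult_pCons_left mult_pCons_right simp add: p_def eq_neg_iff_add_eq_0 add.commute)
qed

section \<open>Coordinates and sums over the twist angles\<close>

lemma sum_lessThan_add:
  fixes f :: "nat \<Rightarrow> 'a :: comm_monoid_add"
  shows "(\<Sum>i<m + n. f i) = (\<Sum>i<m. f i) + (\<Sum>i<n. f (m + i))"
  by (induction n) (simp_all add: add_ac)

lemma mk_state_coord:
  assumes "j < N"
  shows "mk_state N \<sigma> \<theta> \<delta> $ j = \<sigma> j" "mk_state N \<sigma> \<theta> \<delta> $ (N + j) = \<theta> j"
    "mk_state N \<sigma> \<theta> \<delta> $ (2 * N + j) = \<delta> j"
  using assms by (simp_all add: mk_state_def)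

lemma mk_state_carrier [simp]: "mk_state N \<sigma> \<theta> \<delta> \<in> carrier_vec (3 * N)"
  by (simp add: mk_state_def)

lemma block_index_cases:
  fixes i N :: nat
  assumes "i < 3 * N"
  obtains (trace) j where "j < N" "i = j" | (angle) j where "j < N" "i = N + j"
    | (gap) j where "j < N" "i = 2 * N + j"
proof -
  consider "i < N" | "N \<le> i" "i < 2 * N" | "2 * N \<le> i" by linarith
  thus ?thesis
  proof cases
    case 1 thus ?thesis using trace by blast
  next
    case 2 thus ?thesis using angle[of "i - N"] by simp
  next
    case 3 thus ?thesis using gap[of "i - 2 * N"] assms by simp
  qed
qed

lemma rescaled_field_coord:
  assumes "j < N"
  shows "rescaled_field N x $ j = 0"
    and "rescaled_field N x $ (N + j) =
      1 / 4 * (\<Sum>k<N. (gap_coord N x k)\<^sup>2 * sin (4 * (angle_coord N x k - angle_coord N x j)))"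
    and "rescaled_field N x $ (2 * N + j) =
      - gap_coord N x j * (\<Sum>k<N. (gap_coord N x k)\<^sup>2 *
          (sin (2 * (angle_coord N x k - angle_coord N x j)))\<^sup>2) + real N / 2 * gap_coord N x j"
  using assms by (simp_all add: rescaled_field_def Let_def mk_state_coord)

text \<open>
  The sums are real and imaginary part of a multiple of the geometric sum of \<open>exp (2 \<pi> i n / N)\<close>,
  an \<open>N\<close>-th root of unity that differs from \<open>1\<close> exactly because \<open>N\<close> does not divide \<open>n\<close>.
\<close>

lemma sum_cos_sin_roots:
  fixes n :: int
  assumes N: "N \<ge> 2" and nd: "\<not> int N dvd n"
  shows "(\<Sum>k<N. cos (b + 2 * pi * real k * of_int n / real N)) = 0"
    and "(\<Sum>k<N. sin (b + 2 * pi * real k * of_int n / real N)) = 0"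
proof -
  define t where "t = 2 * pi * of_int n / real N"
  have ne: "cis t \<noteq> 1"
  proof
    assume "cis t = 1"
    hence "cos t = 1" by (metis cis.simps(1) one_complex.simps(1))
    then obtain i :: int where "t = i * 2 * pi" by (auto simp: cos_one_2pi_int)
    hence "real_of_int n = of_int i * real N"
      using N by (simp add: t_def field_simps)
    hence "n = i * int N" by (metis of_int_eq_iff of_int_mult of_int_of_nat_eq)
    thus False using nd by simp
  qed
  have "real N * t = 2 * pi * of_int n" using N by (simp add: t_def)
  hence "cis t ^ N = cis (2 * pi * of_int n)" by (metis Complex.DeMoivre)
  also have "\<dots> = 1" by (simp add: cis_multiple_2pi)
  finally have "(\<Sum>k<N. cis t ^ k) = 0"
    using ne by (simp add: geometric_sum)
  hence "(\<Sum>k<N. cis (b + real k * t)) = 0"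
    by (simp add: Complex.DeMoivre flip: cis_mult sum_distrib_left)
  hence "Re (\<Sum>k<N. cis (b + real k * t)) = 0" "Im (\<Sum>k<N. cis (b + real k * t)) = 0" by simp_all
  thus "(\<Sum>k<N. cos (b + 2 * pi * real k * of_int n / real N)) = 0"
    "(\<Sum>k<N. sin (b + 2 * pi * real k * of_int n / real N)) = 0"
    by (simp_all add: t_def mult_ac)
qed

context
  fixes N :: nat and n :: int
  assumes N: "N \<ge> 2" and nd: "\<not> int N dvd n"
begin

lemma sum_cos_sin_twist_angle:
  "(\<Sum>k<N. cos (4 * (twist_angle N n k - \<tau>))) = 0"
  "(\<Sum>k<N. sin (4 * (twist_angle N n k - \<tau>))) = 0"
proof -
  have "4 * (twist_angle N n k - \<tau>) = - 4 * \<tau> + 2 * pi * real k * of_int n / real N" for k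
    using N by (simp add: twist_angle_def field_simps)
  thus "(\<Sum>k<N. cos (4 * (twist_angle N n k - \<tau>))) = 0"
    "(\<Sum>k<N. sin (4 * (twist_angle N n k - \<tau>))) = 0"
    by (simp_all only: sum_cos_sin_roots[OF N nd])
qed

lemma sum_sin_squared_twist_angle: "(\<Sum>k<N. (sin (2 * (twist_angle N n k - \<tau>)))\<^sup>2) = real N / 2"
proof -
  have "(sin (2 * y))\<^sup>2 = 1 / 2 - cos (4 * y) / 2" for y :: real
    using cos_double_sin[of "2 * y"] by (simp add: field_simps)
  thus ?thesis
    using sum_cos_sin_twist_angle(1)[of \<tau>]
    by (simp add: sum_subtractf del: right_diff_distrib_numeral flip: sum_divide_distrib)
qed

lemma twist_point_coord:
  assumes "j < N"
  shows "trace_coord (twist_point N n \<sigma>) j = \<sigma> j"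
    "angle_coord N (twist_point N n \<sigma>) j = twist_angle N n j"
    "gap_coord N (twist_point N n \<sigma>) j = 1"
  using assms by (simp_all add: twist_point_def trace_coord_def angle_coord_def gap_coord_def mk_state_coord)

lemma rescaled_field_twist_point: "rescaled_field N (twist_point N n \<sigma>) = 0\<^sub>v (3 * N)"
proof (rule eq_vecI)
  fix i assume "i < dim_vec (0\<^sub>v (3 * N) :: real vec)"
  hence "i < 3 * N" by simp
  thus "rescaled_field N (twist_point N n \<sigma>) $ i = 0\<^sub>v (3 * N) $ i"
    by (cases rule: block_index_cases)
      (simp_all add: rescaled_field_coord twist_point_coord sum_cos_sin_twist_angle
        sum_sin_squared_twist_angle del: right_diff_distrib_numeral)
qed (simp add: rescaled_field_def mk_state_def Let_def)

section \<open>The Jacobian\<close>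

text \<open>
  The coordinates with index \<open>j\<close> enter every summand of the \<open>j\<close>-th equation. Their joint
  contribution to the derivative carries the factors \<open>\<Sum> cos\<close>, \<open>\<Sum> sin\<close> or \<open>N / 2 - \<Sum> sin\<^sup>2\<close>, and
  all of these vanish, so diagonal entries of the Jacobian follow the same formula as the others.
  The curves \<open>A\<close>, \<open>G\<close> through the twist point are arbitrary, so that one statement serves for the
  partial derivatives in all coordinates.
\<close>

lemma rescaled_field_linearization:
  fixes A G :: "nat \<Rightarrow> real \<Rightarrow> real"
  assumes j: "j < N"
    and A: "\<And>k. k < N \<Longrightarrow> (A k has_real_derivative a k) (at u)"
    and G: "\<And>k. k < N \<Longrightarrow> (G k has_real_derivative g k) (at u)"
    and A0: "\<And>k. k < N \<Longrightarrow> A k u = twist_angle N n k"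
    and G0: "\<And>k. k < N \<Longrightarrow> G k u = 1"
  defines "d \<equiv> \<lambda>k. twist_angle N n k - twist_angle N n j"
  shows "((\<lambda>u. 1 / 4 * (\<Sum>k<N. (G k u)\<^sup>2 * sin (4 * (A k u - A j u)))) has_real_derivative
      (\<Sum>k<N. cos (4 * d k) * a k) + (\<Sum>k<N. sin (4 * d k) / 2 * g k)) (at u)"
    and "((\<lambda>u. - G j u * (\<Sum>k<N. (G k u)\<^sup>2 * (sin (2 * (A k u - A j u)))\<^sup>2) + real N / 2 * G j u)
      has_real_derivative
      (\<Sum>k<N. - 2 * sin (4 * d k) * a k) + (\<Sum>k<N. (cos (4 * d k) - 1) * g k)) (at u)"
proof -
  note [derivative_intros] = A G
  have sin4: "sin (4 * y) = 2 * sin (2 * y) * cos (2 * y)" for y :: real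
    using sin_double[of "2 * y"] by simp
  have cos4: "cos (4 * y) - 1 = - 2 * (sin (2 * y))\<^sup>2" for y :: real
    using cos_double_sin[of "2 * y"] by simp
  have "((\<lambda>u. (G k u)\<^sup>2 * sin (4 * (A k u - A j u))) has_real_derivative
      4 * (cos (4 * d k) * a k + sin (4 * d k) / 2 * g k - cos (4 * d k) * a j)) (at u)" if "k < N" for k
    using that j A0[OF that] A0[OF j] G0[OF that]
    by (auto intro!: derivative_eq_intros simp: d_def algebra_simps)
  hence "((\<lambda>u. 1 / 4 * (\<Sum>k<N. (G k u)\<^sup>2 * sin (4 * (A k u - A j u)))) has_real_derivative
      1 / 4 * (\<Sum>k<N. 4 * (cos (4 * d k) * a k + sin (4 * d k) / 2 * g k - cos (4 * d k) * a j))) (at u)"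
    by (intro DERIV_cmult DERIV_sum) auto
  also have "1 / 4 * (\<Sum>k<N. 4 * (cos (4 * d k) * a k + sin (4 * d k) / 2 * g k - cos (4 * d k) * a j))
      = (\<Sum>k<N. cos (4 * d k) * a k) + (\<Sum>k<N. sin (4 * d k) / 2 * g k) - (\<Sum>k<N. cos (4 * d k)) * a j"
    by (simp add: sum_distrib_left sum_distrib_right sum.distrib sum_subtractf algebra_simps)
  finally show "((\<lambda>u. 1 / 4 * (\<Sum>k<N. (G k u)\<^sup>2 * sin (4 * (A k u - A j u)))) has_real_derivative
      (\<Sum>k<N. cos (4 * d k) * a k) + (\<Sum>k<N. sin (4 * d k) / 2 * g k)) (at u)"
    unfolding d_def sum_cos_sin_twist_angle by simp
  have "((\<lambda>u. (G k u)\<^sup>2 * (sin (2 * (A k u - A j u)))\<^sup>2) has_real_derivative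
      2 * sin (4 * d k) * a k - (cos (4 * d k) - 1) * g k - 2 * sin (4 * d k) * a j) (at u)" if "k < N" for k
    unfolding sin4 cos4 using that j A0[OF that] A0[OF j] G0[OF that]
    by (auto intro!: derivative_eq_intros simp: d_def algebra_simps power2_eq_square)
  hence S: "((\<lambda>u. \<Sum>k<N. (G k u)\<^sup>2 * (sin (2 * (A k u - A j u)))\<^sup>2) has_real_derivative
      (\<Sum>k<N. 2 * sin (4 * d k) * a k - (cos (4 * d k) - 1) * g k - 2 * sin (4 * d k) * a j)) (at u)"
    by (intro DERIV_sum) auto
  have "(\<Sum>k<N. 2 * sin (4 * d k) * a k - (cos (4 * d k) - 1) * g k - 2 * sin (4 * d k) * a j) =
      (\<Sum>k<N. 2 * sin (4 * d k) * a k) - (\<Sum>k<N. (cos (4 * d k) - 1) * g k) - 2 * (\<Sum>k<N. sin (4 * d k)) * a j"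
    by (simp add: sum_distrib_left sum_distrib_right sum_subtractf)
  also have "(\<Sum>k<N. sin (4 * d k)) = 0"
    unfolding d_def by (rule sum_cos_sin_twist_angle)
  finally have S': "((\<lambda>u. \<Sum>k<N. (G k u)\<^sup>2 * (sin (2 * (A k u - A j u)))\<^sup>2) has_real_derivative
      (\<Sum>k<N. 2 * sin (4 * d k) * a k) - (\<Sum>k<N. (cos (4 * d k) - 1) * g k)) (at u)"
    using S by simp
  have 0: "(\<Sum>k<N. (G k u)\<^sup>2 * (sin (2 * (A k u - A j u)))\<^sup>2) = real N / 2"
    using sum_sin_squared_twist_angle[of "twist_angle N n j"] A0 G0 j by simp
  show "((\<lambda>u. - G j u * (\<Sum>k<N. (G k u)\<^sup>2 * (sin (2 * (A k u - A j u)))\<^sup>2) + real N / 2 * G j u)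
      has_real_derivative
      (\<Sum>k<N. - 2 * sin (4 * d k) * a k) + (\<Sum>k<N. (cos (4 * d k) - 1) * g k)) (at u)"
    by (rule DERIV_cong[OF DERIV_add[OF DERIV_mult[OF DERIV_minus[OF G[OF j]] S']
            DERIV_cmult[OF G[OF j]]]])
      (simp add: 0 G0[OF j] sum_negf del: right_diff_distrib_numeral)
qed

text \<open>
  By the addition theorems, the entries of the Jacobian, which depend on the differences of the
  twist angles only, split into three products. The columns of \<open>twist_range\<close> turn out to be
  eigenvectors: two for the eigenvalue \<open>N\<close>, and the common growth of all eigenvalue differences for
  \<open>- N\<close>. The rows of \<open>twist_corange\<close> are the matching linear forms.
\<close>

definition twist_range :: "real mat" where
  "twist_range = Matrix.mat (3 * N) 3 (\<lambda>(i, r).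
     let c = (\<lambda>j. cos (4 * twist_angle N n j)); s = (\<lambda>j. sin (4 * twist_angle N n j)) in
     if i < N then 0
     else if i < 2 * N then [c (i - N), s (i - N), 0] ! r
     else [2 * s (i - 2 * N), - 2 * c (i - 2 * N), 1] ! r)"

definition twist_corange :: "real mat" where
  "twist_corange = Matrix.mat 3 (3 * N) (\<lambda>(r, i).
     let c = (\<lambda>j. cos (4 * twist_angle N n j)); s = (\<lambda>j. sin (4 * twist_angle N n j)) in
     if i < N then 0
     else if i < 2 * N then [c (i - N), s (i - N), 0] ! r
     else [s (i - 2 * N) / 2, - c (i - 2 * N) / 2, - 1] ! r)"

lemma jacobian_twist_point_factorization:
  "jacobian_mat (3 * N) (rescaled_field N) (twist_point N n \<sigma>) = twist_range * twist_corange"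
proof (rule eq_matI)
  fix i k
  assume "i < dim_row (twist_range * twist_corange)" "k < dim_col (twist_range * twist_corange)"
  hence i: "i < 3 * N" and k: "k < 3 * N"
    by (simp_all add: twist_range_def twist_corange_def)
  let ?p = "twist_point N n \<sigma>"
  \<comment> \<open>\<open>e l\<close> is the derivative of coordinate \<open>l\<close> when coordinate \<open>k\<close> is the variable.\<close>
  define e :: "nat \<Rightarrow> real" where "e l = (if l = k then 1 else 0)" for l
  have p: "?p \<in> carrier_vec (3 * N)" by (simp add: twist_point_def)
  have upd: "update_vec ?p k u $ l = (if l = k then u else ?p $ l)" if "l < 3 * N" for u l
    using p that by (simp add: update_vec_def)
  have deriv: "((\<lambda>u. if l = k then u else c) has_real_derivative e l) (at u)" for l u c
    by (auto simp: e_def)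
  define A where "A l u = angle_coord N (update_vec ?p k u) l" for l u
  define G where "G l u = gap_coord N (update_vec ?p k u) l" for l u
  have A: "(A l has_real_derivative e (N + l)) (at (?p $ k))"
    and G: "(G l has_real_derivative e (2 * N + l)) (at (?p $ k))"
    and A0: "A l (?p $ k) = twist_angle N n l" and G0: "G l (?p $ k) = 1" if "l < N" for l
  proof -
    have "A l = (\<lambda>u. if N + l = k then u else ?p $ (N + l))"
      "G l = (\<lambda>u. if 2 * N + l = k then u else ?p $ (2 * N + l))"
      using that by (auto simp: A_def G_def angle_coord_def gap_coord_def upd fun_eq_iff)
    with deriv twist_point_coord[OF that, of \<sigma>]
    show "(A l has_real_derivative e (N + l)) (at (?p $ k))"
      "(G l has_real_derivative e (2 * N + l)) (at (?p $ k))"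
      "A l (?p $ k) = twist_angle N n l" "G l (?p $ k) = 1"
      by (auto simp add: angle_coord_def gap_coord_def)
  qed
  have pick: "(\<Sum>l<N. f l * e (N + l)) = (if N \<le> k \<and> k < 2 * N then f (k - N) else 0)"
    "(\<Sum>l<N. f l * e (2 * N + l)) = (if 2 * N \<le> k then f (k - 2 * N) else 0)" for f
  proof -
    have "(\<Sum>l<N. f l * e (N + l)) = (\<Sum>l<N. if N \<le> k \<and> k - N = l then f l else 0)"
      by (intro sum.cong) (auto simp: e_def)
    thus "(\<Sum>l<N. f l * e (N + l)) = (if N \<le> k \<and> k < 2 * N then f (k - N) else 0)"
      by (auto simp: if_distrib)
    have "(\<Sum>l<N. f l * e (2 * N + l)) = (\<Sum>l<N. if 2 * N \<le> k \<and> k - 2 * N = l then f l else 0)"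
      by (intro sum.cong) (auto simp: e_def)
    thus "(\<Sum>l<N. f l * e (2 * N + l)) = (if 2 * N \<le> k then f (k - 2 * N) else 0)"
      using k by (auto simp: if_distrib)
  qed
  note lin = rescaled_field_linearization[where A = A and G = G and a = "\<lambda>l. e (N + l)"
      and g = "\<lambda>l. e (2 * N + l)" and u = "?p $ k", OF _ A G A0 G0, unfolded pick]
  have UW: "(twist_range * twist_corange) $$ (i, k) =
      twist_range $$ (i, 0) * twist_corange $$ (0, k) + twist_range $$ (i, 1) * twist_corange $$ (1, k)
      + twist_range $$ (i, 2) * twist_corange $$ (2, k)"
  proof -
    have "{0..<3 :: nat} = {0, 1, 2}" by auto
    thus ?thesis
      using i k by (simp add: twist_range_def twist_corange_def scalar_prod_def)
  qed
  have J: "jacobian_mat (3 * N) (rescaled_field N) ?p $$ (i, k) =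
      deriv (\<lambda>u. rescaled_field N (update_vec ?p k u) $ i) (?p $ k)"
    using i k by (simp add: jacobian_mat_def)
  show "jacobian_mat (3 * N) (rescaled_field N) ?p $$ (i, k) = (twist_range * twist_corange) $$ (i, k)"
    using i
  proof (cases rule: block_index_cases)
    case (trace j)
    thus ?thesis
      unfolding J UW using i k by (simp add: rescaled_field_coord twist_range_def)
  next
    case (angle j)
    have "deriv (\<lambda>u. rescaled_field N (update_vec ?p k u) $ i) (?p $ k) =
      (if N \<le> k \<and> k < 2 * N then cos (4 * (twist_angle N n (k - N) - twist_angle N n j)) else 0) +
      (if 2 * N \<le> k then sin (4 * (twist_angle N n (k - 2 * N) - twist_angle N n j)) / 2 else 0)"
      using lin(1)[OF angle(1)] unfolding angle(2) rescaled_field_coord(2)[OF angle(1)] A_def G_def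
      by (rule DERIV_imp_deriv)
    thus ?thesis
      unfolding J UW using i k angle
      by (simp add: twist_range_def twist_corange_def Let_def right_diff_distrib cos_diff sin_diff field_simps)
  next
    case (gap j)
    have "deriv (\<lambda>u. rescaled_field N (update_vec ?p k u) $ i) (?p $ k) =
      (if N \<le> k \<and> k < 2 * N then - 2 * sin (4 * (twist_angle N n (k - N) - twist_angle N n j)) else 0) +
      (if 2 * N \<le> k then cos (4 * (twist_angle N n (k - 2 * N) - twist_angle N n j)) - 1 else 0)"
      using lin(2)[OF gap(1)] unfolding gap(2) rescaled_field_coord(3)[OF gap(1)] A_def G_def
      by (rule DERIV_imp_deriv)
    thus ?thesis
      unfolding J UW using i k gap
      by (simp add: twist_range_def twist_corange_def Let_def right_diff_distrib cos_diff sin_diff field_simps)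
  qed
qed (simp_all add: jacobian_mat_def twist_range_def twist_corange_def)

text \<open>
  The three eigenvectors and the three linear forms are biorthogonal up to scaling. This reduction
  of the spectral problem to size \<open>3\<close> is uniform in \<open>n\<close>; a computation by discrete Fourier modes
  would have to treat the case that \<open>N\<close> divides \<open>2 n\<close> separately.
\<close>

lemma twist_corange_mult_range:
  "twist_corange * twist_range =
     Matrix.mat 3 3 (\<lambda>(r, q). if r = q then [real N, real N, - real N] ! r else 0)"
proof (rule eq_matI)
  fix r q
  assume "r < dim_row (Matrix.mat 3 3 (\<lambda>(r, q). if r = q then [real N, real N, - real N] ! r else 0))"
    "q < dim_col (Matrix.mat 3 3 (\<lambda>(r, q). if r = q then [real N, real N, - real N] ! r else 0))"
  hence rq: "r < 3" "q < 3" by simp_all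
  define c s where "c j = cos (4 * twist_angle N n j)" and "s j = sin (4 * twist_angle N n j)" for j
  have "(twist_corange * twist_range) $$ (r, q)
      = (\<Sum>i<N + N + N. twist_corange $$ (r, i) * twist_range $$ (i, q))"
    using rq by (auto simp: twist_range_def twist_corange_def scalar_prod_def atLeast0LessThan intro!: sum.cong)
  also have "\<dots> = (\<Sum>j<N. twist_corange $$ (r, N + j) * twist_range $$ (N + j, q)
      + twist_corange $$ (r, N + N + j) * twist_range $$ (N + N + j, q))"
    using rq unfolding sum_lessThan_add by (simp add: twist_range_def sum.distrib)
  also have "\<dots> = (\<Sum>j<N. [c j, s j, 0] ! r * [c j, s j, 0] ! q
      + [s j / 2, - c j / 2, - 1] ! r * [2 * s j, - 2 * c j, 1] ! q)"
    using rq by (intro sum.cong) (simp_all add: twist_range_def twist_corange_def Let_def c_def s_def)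
  also have "\<dots> = (if r = q then [real N, real N, - real N] ! r else 0)"
  proof -
    have z: "(\<Sum>j<N. c j) = 0" "(\<Sum>j<N. s j) = 0"
      using sum_cos_sin_twist_angle[of 0] by (simp_all add: c_def s_def)
    have z': "(\<Sum>j<N. s j / 2) = 0" "(\<Sum>j<N. - (2 * s j)) = 0"
      "(\<Sum>j<N. - (c j / 2)) = 0" "(\<Sum>j<N. 2 * c j) = 0"
      by (simp_all add: z sum_negf flip: sum_distrib_left sum_divide_distrib)
    have cs: "c j * c j + s j * s j = 1" "s j * s j + c j * c j = 1" for j
      by (simp_all add: c_def s_def flip: power2_eq_square)
    have "r \<in> {0, 1, 2}" "q \<in> {0, 1, 2}" using rq by auto
    thus ?thesis
      by (elim insertE emptyE) (simp_all add: cs z')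
  qed
  finally show "(twist_corange * twist_range) $$ (r, q) =
      Matrix.mat 3 3 (\<lambda>(r, q). if r = q then [real N, real N, - real N] ! r else 0) $$ (r, q)"
    using rq by simp
qed (simp_all add: twist_range_def twist_corange_def)

lemma char_poly_jacobian_twist_point:
  "char_poly (map_mat complex_of_real (jacobian_mat (3 * N) (rescaled_field N) (twist_point N n \<sigma>))) =
     [:0, 1:] ^ (3 * N - 3) * ([:- of_nat N, 1:] ^ 2 * [:of_nat N, 1:])"
proof -
  let ?U = "map_mat complex_of_real twist_range" and ?W = "map_mat complex_of_real twist_corange"
  define D :: "complex mat" where
    "D = Matrix.mat 3 3 (\<lambda>(r, q). if r = q then [of_nat N, of_nat N, - of_nat N] ! r else 0)"
  have U: "twist_range \<in> carrier_mat (3 * N) 3" and W: "twist_corange \<in> carrier_mat 3 (3 * N)"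
    by (simp_all add: twist_range_def twist_corange_def)
  have DU: "upper_triangular D" and DC: "D \<in> carrier_mat 3 3"
    by (auto simp: D_def)
  have "?W * ?U = D"
    unfolding of_real_hom.mat_hom_mult[OF W U, symmetric] twist_corange_mult_range D_def
    by (intro eq_matI) (auto simp: less_Suc_eq numeral_3_eq_3)
  moreover have "char_poly D = [:- of_nat N, 1:] ^ 2 * [:of_nat N, 1:]"
    unfolding char_poly_upper_triangular[OF DC DU]
    by (simp add: D_def diag_mat_def upt_rec power2_eq_square mult_ac)
  ultimately have "[:0, 1:] ^ 3 * char_poly (?U * ?W) =
      [:0, 1:] ^ (3 * N) * ([:- of_nat N, 1:] ^ 2 * [:of_nat N, 1:])"
    using char_poly_mult_swap[of ?U "3 * N" 3 ?W] U W by simp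
  also have "3 * N = 3 + (3 * N - 3)" using N by simp
  finally have "char_poly (?U * ?W) = [:0, 1:] ^ (3 * N - 3) * ([:- of_nat N, 1:] ^ 2 * [:of_nat N, 1:])"
    unfolding power_add mult.assoc by (subst (asm) mult_cancel_left) auto
  thus ?thesis
    unfolding jacobian_twist_point_factorization of_real_hom.mat_hom_mult[OF U W] .
qed

end

section \<open>The twist orbit of the matrix flow\<close>

lemma trace_coord_matrix: "trace (coord_matrix \<sigma> \<theta> \<delta>) = \<sigma>"
  by (simp add: coord_matrix_eq trace_def sum_2 diag2_def vector_2)

lemma twist_state_coord_matrix:
  assumes "twist_state N n a M" "j < N"
  shows "M j = coord_matrix (trace (M j)) (twist_angle N n j) a"
proof -
  obtain l1 l2 where l: "l2 - l1 = a"
    "M j = rot (twist_angle N n j) ** diag2 l1 l2 ** rot (- twist_angle N n j)"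
    using assms unfolding twist_state_def by blast
  have "(l1 + l2 - a) / 2 = l1" "(l1 + l2 + a) / 2 = l2" using l(1) by (simp_all add: field_simps)
  hence "M j = coord_matrix (l1 + l2) (twist_angle N n j) a"
    unfolding coord_matrix_def l(2) by (simp only:)
  thus ?thesis by (simp add: trace_coord_matrix)
qed

context
  fixes N :: nat and n :: int
  assumes N: "N \<ge> 2" and nd: "\<not> int N dvd n"
begin

text \<open>
  The constant solution of the rescaled system, transported back to the matrix flow. It lives on
  \<open>[0, S]\<close> for every \<open>S\<close>; near a given time \<open>t\<close> the bound \<open>S = s (t + 1)\<close> suffices, since the
  derivative at \<open>t\<close> within \<open>[0, \<infinity>)\<close> only depends on times below \<open>t + 1\<close>.
\<close>

lemma solves_matrix_flow_twist_orbit: "solves_matrix_flow N {0..} (twist_orbit N n a M)"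
  unfolding solves_matrix_flow_def
proof (intro ballI allI impI)
  fix t :: real and i assume t: "t \<in> {0..}" and i: "i < N"
  define s where "s t = ln (1 + real N * a\<^sup>2 * t) / real N" for t
  let ?p = "twist_point N n (\<lambda>j. trace (M j))"
  let ?I = "{r. 0 \<le> r \<and> s r \<le> s (t + 1)}"
  have mono: "s r \<le> s (t + 1)" if "0 \<le> r" "r \<le> t + 1" for r
  proof -
    have "real N * a\<^sup>2 * r \<le> real N * a\<^sup>2 * (t + 1)" "0 \<le> real N * a\<^sup>2 * r"
      using that by (auto intro!: mult_left_mono)
    thus ?thesis unfolding s_def by (intro divide_right_mono) auto
  qed
  have "?p \<in> carrier_vec (3 * N)" by (simp add: twist_point_def)
  hence "solves_ode (3 * N) (rescaled_field N) {0..s (t + 1)} (\<lambda>_. ?p)"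
    by (simp add: solves_ode_def rescaled_field_twist_point[OF N nd])
  from rescaled_solves_matrix_flow[OF _ this, of a, folded s_def, unfolded solves_matrix_flow_def]
  have "((\<lambda>r. coord_matrix (trace_coord ?p i) (angle_coord N ?p i) (amplitude N a r * gap_coord N ?p i))
      has_vector_derivative
      (\<Sum>j<N. commutator
         (coord_matrix (trace_coord ?p j) (angle_coord N ?p j) (amplitude N a t * gap_coord N ?p j))
         (commutator
           (coord_matrix (trace_coord ?p i) (angle_coord N ?p i) (amplitude N a t * gap_coord N ?p i))
           (coord_matrix (trace_coord ?p j) (angle_coord N ?p j) (amplitude N a t * gap_coord N ?p j)))))
      (at t within ?I)"
    using N t i mono[of t] by simp
  hence "((\<lambda>r. twist_orbit N n a M r i) has_vector_derivative
      (\<Sum>j<N. commutator (twist_orbit N n a M t j)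
        (commutator (twist_orbit N n a M t i) (twist_orbit N n a M t j)))) (at t within ?I)"
    using i by (simp add: twist_point_coord[OF N nd] twist_orbit_def)
  also have "at t within ?I = at t within {0..}"
  proof (rule at_within_nhd)
    show "t \<in> {..<t + 1}" "open {..<t + 1}" by simp_all
    show "?I \<inter> {..<t + 1} - {t} = {0..} \<inter> {..<t + 1} - {t}" using mono by auto
  qed
  finally show "((\<lambda>r. twist_orbit N n a M r i) has_vector_derivative
      (\<Sum>j<N. commutator (twist_orbit N n a M t j)
        (commutator (twist_orbit N n a M t i) (twist_orbit N n a M t j)))) (at t within {0..})" .
qed

end

section \<open>A solution that leaves the twist point\<close>

text \<open>
  Let \<open>\<psi>\<^sub>j = 2 \<theta>\<^sub>j\<close> be the doubled angles of the twist state. The trajectory sought has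
  \<open>v\<^sub>j = (sqrt p * cos \<psi>\<^sub>j, sqrt q * sin \<psi>\<^sub>j)\<close>: by the sums over the twist angles the Gram matrix is
  then \<open>N / 2 * diag p q\<close>, and the flow closes up as \<open>p' = N p (1 - q)\<close>, \<open>q' = N q (1 - p)\<close>.
  Since \<open>z = p - q\<close> satisfies \<open>z' = N z\<close>, it may serve as the independent variable; there remains
  \<open>z dp/dz = p (1 - p + z)\<close>, whose solution with \<open>p = 1\<close> at \<open>z = 0\<close> is
  \<open>p = z / (1 - exp (- z))\<close>, and then \<open>q = p exp (- z)\<close>. The constant defined here is \<open>p\<close>.
\<close>

definition unstable_gain :: "real \<Rightarrow> real" where
  "unstable_gain z = z / (1 - exp (- z))"

lemma unstable_gain_pos: "z > 0 \<Longrightarrow> unstable_gain z > 0"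
  by (simp add: unstable_gain_def)

lemma unstable_gain_tendsto: "(unstable_gain \<longlongrightarrow> 1) (at_right 0)"
proof -
  have "((\<lambda>z::real. 1 - exp (- z)) has_real_derivative 1) (at 0)"
    by (auto intro!: derivative_eq_intros)
  hence "((\<lambda>z::real. (1 - exp (- z)) / z) \<longlongrightarrow> 1) (at 0)"
    by (simp add: has_field_derivative_iff)
  from tendsto_inverse[OF this] have "(unstable_gain \<longlongrightarrow> 1) (at 0)"
    by (simp add: unstable_gain_def[abs_def])
  thus ?thesis by (rule filterlim_mono) (simp_all add: at_le)
qed

lemma weighted_squares_pos:
  fixes c s e :: real
  assumes "c\<^sup>2 + s\<^sup>2 = 1" "e > 0"
  shows "c\<^sup>2 + e * s\<^sup>2 > 0"
proof (cases "s = 0")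
  case True thus ?thesis using assms by simp
next
  case False thus ?thesis using assms by (intro add_nonneg_pos) auto
qed

text \<open>
  Compressing the plane by \<open>e\<close> along the second axis turns the unit vector of angle \<open>\<psi>\<close> by the
  \<open>arctan\<close> of the cross product over the inner product of the vector and its image.
\<close>

lemma sheared_angle:
  fixes \<psi> e :: real
  assumes "e > 0"
  defines "\<phi> \<equiv> \<psi> + arctan ((e - 1) * cos \<psi> * sin \<psi> / ((cos \<psi>)\<^sup>2 + e * (sin \<psi>)\<^sup>2))"
    and "r \<equiv> sqrt ((cos \<psi>)\<^sup>2 + e\<^sup>2 * (sin \<psi>)\<^sup>2)"
  shows "r * cos \<phi> = cos \<psi>" "r * sin \<phi> = e * sin \<psi>"
proof -
  define c s where "c = cos \<psi>" and "s = sin \<psi>"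
  have cs: "c\<^sup>2 = 1 - s\<^sup>2" by (simp add: c_def s_def cos_squared_eq)
  define R where "R = c\<^sup>2 + e * s\<^sup>2"
  define t where "t = (e - 1) * c * s / R"
  have R: "R > 0" unfolding R_def using assms(1) by (intro weighted_squares_pos) (simp_all add: cs)
  have r: "r > 0"
    unfolding r_def using assms(1) weighted_squares_pos[of c s "e\<^sup>2"] by (simp add: c_def s_def)
  have r2: "r\<^sup>2 = c\<^sup>2 + e\<^sup>2 * s\<^sup>2" by (simp add: r_def c_def s_def)
  have "R\<^sup>2 + ((e - 1) * c * s)\<^sup>2 = (c\<^sup>2 + e\<^sup>2 * s\<^sup>2) * (c\<^sup>2 + s\<^sup>2)"
    unfolding R_def by (simp add: power2_eq_square algebra_simps)
  also have "\<dots> = r\<^sup>2" by (simp add: r2 cs)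
  finally have "1 + t\<^sup>2 = (r / R)\<^sup>2"
    using R by (simp add: t_def field_simps)
  hence sq: "sqrt (1 + t\<^sup>2) = r / R" using r R by simp
  have ct: "r * cos (arctan t) = R" and st: "r * sin (arctan t) = (e - 1) * c * s"
    unfolding cos_arctan sin_arctan sq using r R by (simp_all add: t_def)
  have \<phi>: "\<phi> = \<psi> + arctan t" by (simp add: \<phi>_def t_def R_def c_def s_def)
  have "r * cos \<phi> = c * (r * cos (arctan t)) - s * (r * sin (arctan t))"
    by (simp add: \<phi> cos_add c_def s_def algebra_simps)
  also have "\<dots> = c * (c\<^sup>2 + s\<^sup>2)"
    unfolding ct st R_def by (simp add: power2_eq_square algebra_simps)
  finally show "r * cos \<phi> = cos \<psi>" by (simp add: cs) (simp add: c_def)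
  have "r * sin \<phi> = s * (r * cos (arctan t)) + c * (r * sin (arctan t))"
    by (simp add: \<phi> sin_add c_def s_def algebra_simps)
  also have "\<dots> = e * s * (c\<^sup>2 + s\<^sup>2)"
    unfolding ct st R_def by (simp add: power2_eq_square algebra_simps)
  finally show "r * sin \<phi> = e * sin \<psi>" by (simp add: cs) (simp add: s_def)
qed

context
  fixes N :: nat and n :: int
begin

text \<open>
  Polar coordinates of these \<open>v\<^sub>j\<close>. The angle must be a continuous function that starts at the twist
  angle itself, not merely at the same angle modulo \<open>\<pi>\<close>; so it is written as the twist angle plus
  half the turn from \<open>(c, s)\<close> to \<open>(c, exp (- z / 2) s)\<close>. That turn stays below a right angle, since
  the two vectors have positive inner product, and hence is an \<open>arctan\<close>.
\<close>

definition unstable_gap :: "nat \<Rightarrow> real \<Rightarrow> real" where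
  "unstable_gap j z = sqrt (unstable_gain z *
     ((cos (2 * twist_angle N n j))\<^sup>2 + exp (- z) * (sin (2 * twist_angle N n j))\<^sup>2))"

definition unstable_angle :: "nat \<Rightarrow> real \<Rightarrow> real" where
  "unstable_angle j z = (let c = cos (2 * twist_angle N n j); s = sin (2 * twist_angle N n j) in
     twist_angle N n j + arctan ((exp (- z / 2) - 1) * c * s / (c\<^sup>2 + exp (- z / 2) * s\<^sup>2)) / 2)"

lemma unstable_gap_pos: "z > 0 \<Longrightarrow> unstable_gap j z > 0"
  using weighted_squares_pos[of "cos (2 * twist_angle N n j)" "sin (2 * twist_angle N n j)" "exp (- z)"]
    unstable_gain_pos[of z]
  by (simp add: unstable_gap_def)

lemma unstable_gap_squared:
  assumes "z > 0"
  shows "(unstable_gap j z)\<^sup>2 = unstable_gain z *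
     ((cos (2 * twist_angle N n j))\<^sup>2 + exp (- z) * (sin (2 * twist_angle N n j))\<^sup>2)"
  using assms unstable_gain_pos[of z] by (simp add: unstable_gap_def)

lemma unstable_polar:
  assumes z: "z > 0"
  shows "unstable_gap j z * cos (2 * unstable_angle j z)
      = sqrt (unstable_gain z) * cos (2 * twist_angle N n j)"
    and "unstable_gap j z * sin (2 * unstable_angle j z)
      = sqrt (unstable_gain z) * exp (- z / 2) * sin (2 * twist_angle N n j)"
proof -
  let ?\<psi> = "2 * twist_angle N n j"
  have "exp (- z) = (exp (- z / 2))\<^sup>2" by (simp flip: exp_of_nat_mult)
  hence gap: "unstable_gap j z = sqrt (unstable_gain z) * sqrt ((cos ?\<psi>)\<^sup>2 + (exp (- z / 2))\<^sup>2 * (sin ?\<psi>)\<^sup>2)"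
    by (simp add: unstable_gap_def real_sqrt_mult)
  have ang: "2 * unstable_angle j z = ?\<psi> + arctan ((exp (- z / 2) - 1) * cos ?\<psi> * sin ?\<psi> /
      ((cos ?\<psi>)\<^sup>2 + exp (- z / 2) * (sin ?\<psi>)\<^sup>2))"
    by (simp add: unstable_angle_def Let_def)
  show "unstable_gap j z * cos (2 * unstable_angle j z) = sqrt (unstable_gain z) * cos ?\<psi>"
    "unstable_gap j z * sin (2 * unstable_angle j z) = sqrt (unstable_gain z) * exp (- z / 2) * sin ?\<psi>"
    unfolding gap ang using sheared_angle[of "exp (- z / 2)" ?\<psi>] by (simp_all add: mult.assoc)
qed

text \<open>
  The equations of motion see the state only through the squares \<open>v\<^sub>j\<^sup>2\<close> (as complex numbers) and
  their absolute values, which contain no square roots.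
\<close>

lemma unstable_doubled:
  assumes z: "z > 0"
  shows "(unstable_gap j z)\<^sup>2 * cos (4 * unstable_angle j z)
      = unstable_gain z * ((cos (2 * twist_angle N n j))\<^sup>2 - exp (- z) * (sin (2 * twist_angle N n j))\<^sup>2)"
    and "(unstable_gap j z)\<^sup>2 * sin (4 * unstable_angle j z)
      = unstable_gain z * exp (- z / 2) * sin (4 * twist_angle N n j)"
proof -
  define g C S where "g = unstable_gap j z" and "C = cos (2 * unstable_angle j z)" and "S = sin (2 * unstable_angle j z)"
  have p: "g * C = sqrt (unstable_gain z) * cos (2 * twist_angle N n j)"
    "g * S = sqrt (unstable_gain z) * exp (- z / 2) * sin (2 * twist_angle N n j)"
    using unstable_polar[OF z, of j] by (simp_all add: g_def C_def S_def)
  have e: "(exp (- (z / 2)))\<^sup>2 = exp (- z)" by (simp flip: exp_of_nat_mult)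
  have CS: "cos (4 * unstable_angle j z) = C\<^sup>2 - S\<^sup>2" "sin (4 * unstable_angle j z) = 2 * S * C"
    using cos_double[of "2 * unstable_angle j z"] sin_double[of "2 * unstable_angle j z"]
    by (simp_all add: C_def S_def)
  have "g\<^sup>2 * cos (4 * unstable_angle j z) = (g * C)\<^sup>2 - (g * S)\<^sup>2"
    "g\<^sup>2 * sin (4 * unstable_angle j z) = 2 * (g * S) * (g * C)"
    unfolding CS by (simp_all add: power2_eq_square algebra_simps)
  moreover have "sin (4 * twist_angle N n j) = 2 * sin (2 * twist_angle N n j) * cos (2 * twist_angle N n j)"
    using sin_double[of "2 * twist_angle N n j"] by simp
  moreover have "sqrt (unstable_gain z) * sqrt (unstable_gain z) = unstable_gain z"
    using unstable_gain_pos[OF z] by simp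
  ultimately show "(unstable_gap j z)\<^sup>2 * cos (4 * unstable_angle j z)
      = unstable_gain z * ((cos (2 * twist_angle N n j))\<^sup>2 - exp (- z) * (sin (2 * twist_angle N n j))\<^sup>2)"
    "(unstable_gap j z)\<^sup>2 * sin (4 * unstable_angle j z)
      = unstable_gain z * exp (- z / 2) * sin (4 * twist_angle N n j)"
    unfolding p using unstable_gain_pos[OF z]
    by (simp_all add: g_def power_mult_distrib e right_diff_distrib mult_ac)
qed

text \<open>
  In terms of \<open>z\<close> the angles decouple from each other, because the sum of all \<open>v\<^sub>k\<^sup>2\<close> depends on \<open>z\<close>
  alone: it is \<open>N / 2 * (p - q) = N / 2 * z\<close>.
\<close>

lemma unstable_angle_deriv:
  assumes z: "z > 0"
  shows "(unstable_angle j has_real_derivative - sin (4 * unstable_angle j z) / 8) (at z)"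
proof -
  define c s e where "c = cos (2 * twist_angle N n j)" and "s = sin (2 * twist_angle N n j)"
    and "e = exp (- z / 2)"
  define R where "R = c\<^sup>2 + e * s\<^sup>2"
  define Q where "Q = c\<^sup>2 + e\<^sup>2 * s\<^sup>2"
  have cs: "c\<^sup>2 + s\<^sup>2 = 1" by (simp add: c_def s_def)
  have e: "e > 0" by (simp add: e_def)
  have R: "R > 0" and Q: "Q > 0"
    unfolding R_def Q_def using cs e by (auto intro!: weighted_squares_pos)
  have key: "R\<^sup>2 + ((e - 1) * c * s)\<^sup>2 = Q"
  proof -
    have "R\<^sup>2 + ((e - 1) * c * s)\<^sup>2 = Q * (c\<^sup>2 + s\<^sup>2)"
      unfolding R_def Q_def by (simp add: power2_eq_square algebra_simps)
    thus ?thesis by (simp add: cs)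
  qed
  have num: "R - (e - 1) * s\<^sup>2 = 1"
    unfolding R_def using cs by (simp add: algebra_simps)
  have E: "((\<lambda>z. exp (- z / 2)) has_real_derivative - e / 2) (at z)"
    by (auto intro!: derivative_eq_intros simp: e_def)
  have "((\<lambda>z. (exp (- z / 2) - 1) * c * s / (c\<^sup>2 + exp (- z / 2) * s\<^sup>2)) has_real_derivative
      ((- e / 2 * c * s) * R - (e - 1) * c * s * (- e / 2 * s\<^sup>2)) / (R * R)) (at z)"
    by (rule E derivative_eq_intros refl)+ (use R in \<open>auto simp: R_def e_def\<close>)
  also have "(- e / 2 * c * s) * R - (e - 1) * c * s * (- e / 2 * s\<^sup>2)
      = (- e / 2 * c * s) * (R - (e - 1) * s\<^sup>2)"
    by (simp add: field_simps)
  finally have T: "((\<lambda>z. (exp (- z / 2) - 1) * c * s / (c\<^sup>2 + exp (- z / 2) * s\<^sup>2)) has_real_derivative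
      (- e / 2 * c * s) / (R * R)) (at z)"
    by (simp add: num)
  have "((\<lambda>z. twist_angle N n j + arctan ((exp (- z / 2) - 1) * c * s / (c\<^sup>2 + exp (- z / 2) * s\<^sup>2)) / 2)
      has_real_derivative
      inverse (1 + ((e - 1) * c * s / R)\<^sup>2) * ((- e / 2 * c * s) / (R * R)) / 2) (at z)"
    by (rule DERIV_cong[OF DERIV_add[OF DERIV_const
            DERIV_cdivide[OF DERIV_chain2[OF DERIV_arctan T]]]])
      (simp only: e_def R_def add_0_left)
  moreover have "1 + ((e - 1) * c * s / R)\<^sup>2 = Q / (R * R)"
    using key R by (simp add: field_simps power2_eq_square)
  moreover have "inverse (Q / (R * R)) * ((- e / 2 * c * s) / (R * R)) / 2 = - (e * c * s) / (4 * Q)"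
    using R Q by (simp add: field_simps)
  moreover have "(\<lambda>z. twist_angle N n j + arctan ((exp (- z / 2) - 1) * c * s / (c\<^sup>2 + exp (- z / 2) * s\<^sup>2)) / 2)
      = unstable_angle j"
    by (simp add: unstable_angle_def c_def s_def Let_def fun_eq_iff)
  moreover have "- (e * c * s) / (4 * Q) = - sin (4 * unstable_angle j z) / 8"
  proof -
    have e2: "e\<^sup>2 = exp (- z)" by (simp add: e_def flip: exp_of_nat_mult)
    have "unstable_gain z * (Q * sin (4 * unstable_angle j z)) = unstable_gain z * (e * (2 * s * c))"
      using unstable_doubled(2)[OF z, of j] sin_double[of "2 * twist_angle N n j"]
      unfolding unstable_gap_squared[OF z] by (simp add: Q_def c_def s_def e2) (simp add: e_def)
    hence "Q * sin (4 * unstable_angle j z) = e * (2 * s * c)"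
      using unstable_gain_pos[OF z] by simp
    thus ?thesis using Q by (simp add: field_simps)
  qed
  ultimately show ?thesis by (simp only:)
qed

text \<open>
  The three terms in the growth rate of a gap stem from the rescaling, from
  \<open>\<Sum> |v\<^sub>k|\<^sup>2 = N / 2 * (p + q)\<close> and from \<open>\<Sum> v\<^sub>k\<^sup>2 = N / 2 * z\<close>.
\<close>

lemma unstable_gap_deriv:
  assumes z: "z > 0"
  shows "(unstable_gap j has_real_derivative unstable_gap j z / (2 * z) *
      (1 - unstable_gain z * (1 + exp (- z)) / 2 + z / 2 * cos (4 * unstable_angle j z))) (at z)"
proof -
  define c s e where "c = (cos (2 * twist_angle N n j))\<^sup>2" and "s = (sin (2 * twist_angle N n j))\<^sup>2"
    and "e = exp (- z)"
  define p g where "p = unstable_gain z" and "g = unstable_gap j z"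
  have e: "e < 1" "e > 0" using z by (simp_all add: e_def)
  have cs: "c = 1 - s" by (simp add: c_def s_def cos_squared_eq)
  have pz: "p * (1 - e) = z" using e by (simp add: p_def unstable_gain_def e_def)
  have g: "g > 0" and p: "p > 0"
    using unstable_gap_pos[OF z] unstable_gain_pos[OF z] by (simp_all add: g_def p_def)
  have g2: "g\<^sup>2 = p * (c + e * s)"
    unfolding g_def p_def c_def s_def e_def by (rule unstable_gap_squared[OF z])
  have E: "((\<lambda>z. exp (- z)) has_real_derivative - e) (at z)"
    by (auto intro!: derivative_eq_intros simp: e_def)
  have "(unstable_gain has_real_derivative (1 * (1 - e) - z * e) / ((1 - e) * (1 - e))) (at z)"
    unfolding unstable_gain_def[abs_def]
    by (rule E derivative_eq_intros refl)+ (use e in \<open>auto simp: e_def\<close>)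
  also have "(1 * (1 - e) - z * e) / ((1 - e) * (1 - e)) = p * (1 - p * e) / z"
  proof -
    have "1 * (1 - e) - z * e = (1 - e) * (1 - p * e)"
      unfolding pz[symmetric] by (simp add: algebra_simps)
    thus ?thesis using e p unfolding pz[symmetric] by simp
  qed
  finally have P: "(unstable_gain has_real_derivative p * (1 - p * e) / z) (at z)" .
  have "((\<lambda>z. unstable_gain z * (c + exp (- z) * s)) has_real_derivative
      p * (1 - p * e) / z * (c + e * s) + (- e * s) * p) (at z)"
    by (rule P E derivative_eq_intros refl)+ (simp add: p_def e_def)
  from DERIV_chain2[OF DERIV_real_sqrt this]
  have "((\<lambda>z. sqrt (unstable_gain z * (c + exp (- z) * s))) has_real_derivative
      inverse g / 2 * (p * (1 - p * e) / z * (c + e * s) + (- e * s) * p)) (at z)"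
    using g g2 by (simp add: g_def p_def e_def unstable_gap_def c_def s_def)
  moreover have "(\<lambda>z. sqrt (unstable_gain z * (c + exp (- z) * s))) = unstable_gap j"
    by (simp add: unstable_gap_def c_def s_def fun_eq_iff)
  moreover have "inverse g / 2 * (p * (1 - p * e) / z * (c + e * s) + (- e * s) * p) =
      g / (2 * z) * (1 - p * (1 + e) / 2 + z / 2 * cos (4 * unstable_angle j z))"
  proof -
    have d: "g\<^sup>2 * cos (4 * unstable_angle j z) = p * (c - e * s)"
      unfolding g_def p_def c_def s_def e_def by (rule unstable_doubled(1)[OF z])
    have "p * (1 - p * e) * (c + e * s) + (- e * s) * p * z = 
        g\<^sup>2 * (1 - p * (1 + e) / 2) + z / 2 * (p * (c - e * s))"
      unfolding pz[symmetric] g2 cs by (simp add: field_simps power2_eq_square)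
    also have "\<dots> = g\<^sup>2 * (1 - p * (1 + e) / 2 + z / 2 * cos (4 * unstable_angle j z))"
      unfolding d[symmetric] by (simp add: algebra_simps)
    finally have "(p * (1 - p * e) * (c + e * s) + (- e * s) * p * z) / (2 * g * z) = 
      g\<^sup>2 * (1 - p * (1 + e) / 2 + z / 2 * cos (4 * unstable_angle j z)) / (2 * g * z)"
      by simp
    moreover have "g\<^sup>2 * x / (2 * g * z) = g / (2 * z) * x" for x
      using g by (simp add: power2_eq_square)
    moreover have "(p * (1 - p * e) * (c + e * s) + (- e * s) * p * z) / (2 * g * z) =
      inverse g / 2 * (p * (1 - p * e) / z * (c + e * s) + (- e * s) * p)"
      using g z by (simp add: field_simps)
    ultimately show ?thesis by simp
  qed
  ultimately show ?thesis by (simp only: g_def p_def e_def)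
qed

lemma unstable_gap_tendsto: "(unstable_gap j \<longlongrightarrow> 1) (at_right 0)"
proof -
  let ?\<psi> = "2 * twist_angle N n j"
  have "(unstable_gap j \<longlongrightarrow> sqrt (1 * ((cos ?\<psi>)\<^sup>2 + exp (- 0) * (sin ?\<psi>)\<^sup>2))) (at_right 0)"
    unfolding unstable_gap_def[abs_def]
    by (intro tendsto_intros unstable_gain_tendsto)
  thus ?thesis by simp
qed

lemma unstable_angle_tendsto: "(unstable_angle j \<longlongrightarrow> twist_angle N n j) (at_right 0)"
proof -
  let ?\<psi> = "2 * twist_angle N n j"
  have "(unstable_angle j \<longlongrightarrow> twist_angle N n j + arctan ((exp (- 0 / 2) - 1) * cos ?\<psi> * sin ?\<psi> /
      ((cos ?\<psi>)\<^sup>2 + exp (- 0 / 2) * (sin ?\<psi>)\<^sup>2)) / 2) (at_right 0)"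
    unfolding unstable_angle_def[abs_def] Let_def
    by (intro tendsto_intros) auto
  thus ?thesis by simp
qed
end

context
  fixes N :: nat and n :: int
  assumes N: "N \<ge> 2" and nd: "\<not> int N dvd n"
begin

text \<open>
  Every sum over \<open>k\<close> is a fixed linear combination of \<open>\<Sum> |v\<^sub>k|\<^sup>2 = N / 2 * (p + q)\<close> and the
  real and imaginary parts \<open>N / 2 * (p - q)\<close> and \<open>0\<close> of \<open>\<Sum> v\<^sub>k\<^sup>2\<close>.
\<close>

lemma unstable_sums:
  assumes z: "z > 0"
  shows "(\<Sum>k<N. (unstable_gap N n k z)\<^sup>2 * sin (4 * (unstable_angle N n k z - \<tau>)))
      = - (real N / 2 * z * sin (4 * \<tau>))"
    and "(\<Sum>k<N. (unstable_gap N n k z)\<^sup>2 * (sin (2 * (unstable_angle N n k z - \<tau>)))\<^sup>2)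
      = real N / 4 * (unstable_gain z * (1 + exp (- z)) - z * cos (4 * \<tau>))"
proof -
  define p e where "p = unstable_gain z" and "e = exp (- z)"
  have pz: "p * (1 - e) = z" using z by (simp add: p_def unstable_gain_def e_def)
  define g2 C S where "g2 k = (unstable_gap N n k z)\<^sup>2" and "C k = g2 k * cos (4 * unstable_angle N n k z)"
    and "S k = g2 k * sin (4 * unstable_angle N n k z)" for k
  have c2: "(cos (2 * y))\<^sup>2 = 1 / 2 + cos (4 * y) / 2" and s2: "(sin (2 * y))\<^sup>2 = 1 / 2 - cos (4 * y) / 2" for y :: real
    using cos_double_cos[of "2 * y"] cos_double_sin[of "2 * y"] by (simp_all add: field_simps)
  have zero: "(\<Sum>k<N. cos (4 * twist_angle N n k)) = 0" "(\<Sum>k<N. sin (4 * twist_angle N n k)) = 0"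
    using sum_cos_sin_twist_angle[OF N nd, of 0] by simp_all
  have "g2 k = p * (1 + e) / 2 + p * (1 - e) / 2 * cos (4 * twist_angle N n k)" for k
    unfolding g2_def unstable_gap_squared[OF z] c2 s2 p_def e_def by (simp add: field_simps)
  hence G: "(\<Sum>k<N. g2 k) = real N / 2 * (p * (1 + e))"
    by (simp add: sum.distrib zero flip: sum_distrib_left sum_divide_distrib)
  have "C k = p * (1 - e) / 2 + p * (1 + e) / 2 * cos (4 * twist_angle N n k)" for k
    unfolding C_def g2_def unstable_doubled[OF z] c2 s2 p_def e_def by (simp add: field_simps)
  hence C: "(\<Sum>k<N. C k) = real N / 2 * z"
    by (simp add: sum.distrib zero pz flip: sum_distrib_left sum_divide_distrib)
  have S: "(\<Sum>k<N. S k) = 0"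
    unfolding S_def g2_def unstable_doubled[OF z] by (simp add: zero flip: sum_distrib_left)
  have "(\<Sum>k<N. g2 k * sin (4 * (unstable_angle N n k z - \<tau>))) = (\<Sum>k<N. S k * cos (4 * \<tau>) - C k * sin (4 * \<tau>))"
    by (intro sum.cong) (simp_all add: S_def C_def right_diff_distrib sin_diff)
  also have "\<dots> = - (real N / 2 * z * sin (4 * \<tau>))"
    by (simp add: sum_subtractf C S flip: sum_distrib_right)
  finally show "(\<Sum>k<N. (unstable_gap N n k z)\<^sup>2 * sin (4 * (unstable_angle N n k z - \<tau>)))
      = - (real N / 2 * z * sin (4 * \<tau>))" by (simp add: g2_def)
  have "(\<Sum>k<N. g2 k * (sin (2 * (unstable_angle N n k z - \<tau>)))\<^sup>2)
      = (\<Sum>k<N. g2 k / 2 - C k * (cos (4 * \<tau>) / 2) - S k * (sin (4 * \<tau>) / 2))"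
    unfolding s2 by (intro sum.cong) (simp_all add: S_def C_def right_diff_distrib cos_diff field_simps)
  also have "\<dots> = real N / 4 * (p * (1 + e) - z * cos (4 * \<tau>))"
    by (simp add: sum_subtractf C S G right_diff_distrib flip: sum_distrib_right sum_divide_distrib)
  finally show "(\<Sum>k<N. (unstable_gap N n k z)\<^sup>2 * (sin (2 * (unstable_angle N n k z - \<tau>)))\<^sup>2)
      = real N / 4 * (unstable_gain z * (1 + exp (- z)) - z * cos (4 * \<tau>))"
    by (simp add: g2_def p_def e_def)
qed

definition unstable_state :: "(nat \<Rightarrow> real) \<Rightarrow> real \<Rightarrow> real vec" where
  "unstable_state \<sigma> z = mk_state N \<sigma> (\<lambda>j. unstable_angle N n j z) (\<lambda>j. unstable_gap N n j z)"

text \<open>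
  Dividing by \<open>N z\<close> is the change of the independent variable from \<open>s\<close> to \<open>z\<close>, as \<open>dz/ds = N z\<close>.
\<close>

lemma unstable_state_deriv:
  assumes z: "z > 0" and i: "i < 3 * N"
  shows "((\<lambda>z. unstable_state \<sigma> z $ i) has_real_derivative
      rescaled_field N (unstable_state \<sigma> z) $ i / (real N * z)) (at z)"
proof -
  have ang: "angle_coord N (unstable_state \<sigma> z) k = unstable_angle N n k z"
    and gap: "gap_coord N (unstable_state \<sigma> z) k = unstable_gap N n k z" if "k < N" for k
    using that by (simp_all add: angle_coord_def gap_coord_def unstable_state_def mk_state_coord)
  show ?thesis using i
  proof (cases rule: block_index_cases)
    case (trace j)
    thus ?thesis by (simp add: rescaled_field_coord unstable_state_def mk_state_coord)
  next
    case (angle j)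
    have "rescaled_field N (unstable_state \<sigma> z) $ (N + j) / (real N * z) = - sin (4 * unstable_angle N n j z) / 8"
      using angle(1) z N
      by (simp add: rescaled_field_coord ang gap unstable_sums(1)[OF z] del: right_diff_distrib_numeral)
    thus ?thesis
      using unstable_angle_deriv[OF z, of N n j] angle by (simp add: unstable_state_def mk_state_coord)
  next
    case (gap j)
    have "rescaled_field N (unstable_state \<sigma> z) $ (2 * N + j) / (real N * z) = unstable_gap N n j z / (2 * z) *
      (1 - unstable_gain z * (1 + exp (- z)) / 2 + z / 2 * cos (4 * unstable_angle N n j z))"
      using gap(1) z N
      by (simp add: rescaled_field_coord ang \<open>\<And>k. k < N \<Longrightarrow> gap_coord N (unstable_state \<sigma> z) k = unstable_gap N n k z\<close>
          unstable_sums(2)[OF z] del: right_diff_distrib_numeral) (simp add: field_simps)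
    thus ?thesis
      using unstable_gap_deriv[OF z, of N n j] gap by (simp add: unstable_state_def mk_state_coord)
  qed
qed

lemma solves_ode_unstable_state:
  assumes "d > 0"
  shows "solves_ode (3 * N) (rescaled_field N) I (\<lambda>s. unstable_state \<sigma> (d * exp (real N * s)))"
  unfolding solves_ode_def
proof (intro ballI conjI allI impI)
  fix s i assume i: "i < 3 * N"
  let ?z = "d * exp (real N * s)"
  have z: "?z > 0" using assms by simp
  have "((\<lambda>s. d * exp (real N * s)) has_real_derivative real N * ?z) (at s within I)"
    by (auto intro!: derivative_eq_intros)
  note * = DERIV_chain2[OF unstable_state_deriv[OF z i] this]
  have "y / (real N * ?z) * (real N * ?z) = y" for y
    using assms N by simp
  with * show "((\<lambda>s. unstable_state \<sigma> (d * exp (real N * s)) $ i) has_real_derivative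
      rescaled_field N (unstable_state \<sigma> ?z) $ i) (at s within I)"
    by (simp only:)
qed (simp add: unstable_state_def)

lemma unstable_state_tendsto:
  "((\<lambda>z. euclid_dist (3 * N) (unstable_state \<sigma> z) (twist_point N n \<sigma>)) \<longlongrightarrow> 0) (at_right 0)"
proof -
  have "((\<lambda>z. unstable_state \<sigma> z $ i) \<longlongrightarrow> twist_point N n \<sigma> $ i) (at_right 0)" if "i < 3 * N" for i
    using that
    by (cases rule: block_index_cases)
      (simp_all add: unstable_state_def twist_point_def mk_state_coord unstable_angle_tendsto unstable_gap_tendsto)
  hence "((\<lambda>z. euclid_dist (3 * N) (unstable_state \<sigma> z) (twist_point N n \<sigma>)) \<longlongrightarrow>
      sqrt (\<Sum>i<3 * N. (twist_point N n \<sigma> $ i - twist_point N n \<sigma> $ i)\<^sup>2)) (at_right 0)"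
    unfolding euclid_dist_def L2_set_def by (intro tendsto_intros) auto
  thus ?thesis by simp
qed

text \<open>
  The solution through \<open>z = d\<close> starts arbitrarily close to the fixed point for small \<open>d\<close>, but always
  reaches the same distant state \<open>z = 1\<close>, at time \<open>ln (1 / d) / N\<close>.
\<close>

theorem twist_point_not_lyapunov_stable:
  "\<not> lyapunov_stable (3 * N) (rescaled_field N) (twist_point N n \<sigma>)"
proof
  assume stable: "lyapunov_stable (3 * N) (rescaled_field N) (twist_point N n \<sigma>)"
  \<comment> \<open>The first twist angle is \<open>0\<close>, so there the gap is simply \<open>sqrt p\<close>, which exceeds \<open>1\<close>.\<close>
  define \<epsilon> where "\<epsilon> = unstable_gap N n 0 1 - 1"
  have "unstable_gain 1 > 1" by (simp add: unstable_gain_def)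
  hence "\<epsilon> > 0" by (simp add: \<epsilon>_def unstable_gap_def twist_angle_def)
  with stable obtain \<delta> where "\<delta> > 0" and \<delta>: "\<And>T x s. T \<ge> 0 \<Longrightarrow> solves_ode (3 * N) (rescaled_field N) {0..T} x \<Longrightarrow>
      euclid_dist (3 * N) (x 0) (twist_point N n \<sigma>) < \<delta> \<Longrightarrow> s \<in> {0..T} \<Longrightarrow>
      euclid_dist (3 * N) (x s) (twist_point N n \<sigma>) < \<epsilon>"
    unfolding lyapunov_stable_def by metis
  have "\<forall>\<^sub>F d in at_right 0. euclid_dist (3 * N) (unstable_state \<sigma> d) (twist_point N n \<sigma>) < \<delta>"
    using unstable_state_tendsto \<open>\<delta> > 0\<close> by (rule order_tendstoD)
  moreover have "\<forall>\<^sub>F d in at_right 0. d < (1 :: real)"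
    by (rule order_tendstoD(2)[OF tendsto_ident_at]) simp
  moreover have "\<forall>\<^sub>F d in at_right 0. d > (0 :: real)" by (rule eventually_at_right_less)
  ultimately have "\<forall>\<^sub>F d in at_right 0. euclid_dist (3 * N) (unstable_state \<sigma> d) (twist_point N n \<sigma>) < \<delta> \<and> d < 1 \<and> d > 0"
    by eventually_elim simp
  then obtain d where d: "euclid_dist (3 * N) (unstable_state \<sigma> d) (twist_point N n \<sigma>) < \<delta>" "d < 1" "d > 0"
    by (metis (no_types, lifting) eventually_happens trivial_limit_at_right_real)
  define T where "T = ln (1 / d) / real N"
  have T: "T \<ge> 0"
    unfolding T_def using d by (intro divide_nonneg_nonneg) (simp_all add: ln_div)
  have dT: "d * exp (real N * T) = 1"
    using d N by (simp add: T_def)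
  have "euclid_dist (3 * N) (unstable_state \<sigma> 1) (twist_point N n \<sigma>) < \<epsilon>"
    using \<delta>[OF T solves_ode_unstable_state[OF d(3)], of \<sigma> T] d T dT by simp
  moreover have "\<epsilon> \<le> euclid_dist (3 * N) (unstable_state \<sigma> 1) (twist_point N n \<sigma>)"
  proof -
    have "unstable_state \<sigma> 1 $ (2 * N) - twist_point N n \<sigma> $ (2 * N) = \<epsilon>"
      using mk_state_coord(3)[of 0 N] N by (simp add: unstable_state_def twist_point_def \<epsilon>_def)
    moreover have "unstable_state \<sigma> 1 $ (2 * N) - twist_point N n \<sigma> $ (2 * N)
        \<le> euclid_dist (3 * N) (unstable_state \<sigma> 1) (twist_point N n \<sigma>)"
      unfolding euclid_dist_def using N
      by (intro member_le_L2_set[of _ _ "\<lambda>i. unstable_state \<sigma> 1 $ i - twist_point N n \<sigma> $ i"]) auto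
    ultimately show ?thesis by simp
  qed
  ultimately show False by simp
qed

end

section \<open>The fixed point of a twist state\<close>

theorem theorem2p3:
  fixes N :: nat and n :: int and a :: real and M :: "nat \<Rightarrow> real^2^2"
  assumes "N \<ge> 2"
    and "\<not> int N dvd n"
    and "twist_state N n a M"
  shows
    "(\<forall>j<N. twist_orbit N n a M 0 j = M j) \<and>
     solves_matrix_flow N {0..} (twist_orbit N n a M) \<and>
     rescaled_field N (twist_point N n (\<lambda>j. trace (M j))) = 0\<^sub>v (3 * N) \<and>
     \<not> lyapunov_stable (3 * N) (rescaled_field N) (twist_point N n (\<lambda>j. trace (M j))) \<and>
     (\<forall>\<sigma>. let J = map_mat complex_of_real (jacobian_mat (3 * N) (rescaled_field N) (twist_point N n \<sigma>)) in
        spectrum J = {- of_nat N, of_nat N, 0} \<and>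
        order (- of_nat N) (char_poly J) = 1 \<and>
        order (of_nat N) (char_poly J) = 2 \<and>
        order 0 (char_poly J) = 3 * N - 3)"
proof (intro conjI allI)
  fix \<sigma>
  let ?J = "map_mat complex_of_real (jacobian_mat (3 * N) (rescaled_field N) (twist_point N n \<sigma>))"
  have J: "?J \<in> carrier_mat (3 * N) (3 * N)" by (simp add: jacobian_mat_def)
  have "spectrum ?J = {z. poly (char_poly ?J) z = 0}"
    by (simp add: spectrum_root_char_poly[OF J])
  thus "let J = ?J in
      spectrum J = {- of_nat N, of_nat N, 0} \<and>
      order (- of_nat N) (char_poly J) = 1 \<and>
      order (of_nat N) (char_poly J) = 2 \<and>
      order 0 (char_poly J) = 3 * N - 3"
    unfolding Let_def char_poly_jacobian_twist_point[OF assms(1,2)]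
    using order_linear_factors[of "of_nat N" "3 * N - 3"] assms(1) by simp
next
  fix j
  show "j < N \<longrightarrow> twist_orbit N n a M 0 j = M j"
    using twist_state_coord_matrix[OF assms(3)] by (simp add: twist_orbit_def amplitude_def)
qed (simp_all only: solves_matrix_flow_twist_orbit[OF assms(1,2)]
      rescaled_field_twist_point[OF assms(1,2)] twist_point_not_lyapunov_stable[OF assms(1,2)] not_False_eq_True)

end
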